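(* Fix a prime number $p\ge 3$. Define $\varphi_1$ on complex polynomials as follows: $\varphi_1(c)=0$ for every constant polynomial $c$; for a nonconstant prime polynomial $P$, $$\varphi_1(P)=\begin{cases} p & \text{if } P\in H(z^p),\\ 1 & \text{otherwise;}\end{cases}$$ and for a nonconstant polynomial $P$ with prime decomposition $P=P_1\circ\cdots\circ P_n$, $\varphi_1(P)=\varphi_1(P_1)\cdots\varphi_1(P_n)$. Then $\varphi_1$ is well defined (independent of the chosen prime decomposition) and is a multiplicative character on $\mathcal{P}ol(\mathbb{C})$; it is not elementary; and it cannot be extended to rational functions, i.e. there is no multiplicative character $\Phi:\mathcal{R}at(\mathbb{C})\to\mathbb{C}$ with $\Phi|_{\mathcal{P}ol(\mathbb{C})}=\varphi_1$.
   Context: $\mathcal{P}ol(\mathbb{C})$ is the semigroup (under composition) of all complex polynomials, constants included. $\mathcal{R}at(\mathbb{C})$ is the semigroup (under composition) of all rational functions $\widehat{\mathbb{C}}\to\widehat{\mathbb{C}}$ of the Riemann sphere, constants included; $\mathcal{P}ol(\mathbb{C})$ is a subsemigroup of it. A multiplicative character on a semigroup $S$ is a map $\varphi:S\to\mathbb{C}$ with $\varphi(st)=\varphi(s)\varphi(t)$ for all $s,t\in S$. A multiplicative character $\varphi$ on $\mathcal{P}ol(\mathbb{C})$ is elementary if $\varphi(P)=f(\deg P)$ for all $P$, for some function $f$ with $f(nm)=f(n)f(m)$. A nonconstant polynomial $P$ is prime if whenever $P=Q\circ R$ with $Q,R$ polynomials, $\deg Q=1$ or $\deg R=1$ (so degree-one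 polynomials are prime). A prime decomposition of $P$ is an expression $P=P_1\circ\cdots\circ P_n$ with every $P_i$ prime. For a rational map $R$, its Hurwitz class is $H(R)=\{Q\in\mathcal{R}at(\mathbb{C}) : \exists\,\phi,\psi \text{ homeomorphisms of } \widehat{\mathbb{C}} \text{ with } Q\circ\phi=\psi\circ R\}$. *)

theory Defs
  imports "HOL-Analysis.Analysis" "HOL-Computational_Algebra.Computational_Algebra"
begin

section \<open>The Riemann sphere and rational maps\<close>

text \<open>The point at infinity is \<^term>\<open>None\<close>.\<close>

type_synonym sphere = "complex option"

definition sphere_top :: "sphere topology" where
  "sphere_top = Alexandroff_compactification euclidean"

lemma topspace_sphere_top [simp]: "topspace sphere_top = UNIV"
  by (auto simp: sphere_top_def UNIV_option_conv)

text \<open>The self-map \<open>P/Q\<close> of the sphere, meaningful when \<open>P\<close> and \<open>Q\<close> are coprime. The pair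
  \<open>P = 1\<close>, \<open>Q = 0\<close> is coprime and gives the constant map \<open>\<infinity>\<close>.\<close>

definition rat_map :: "complex poly \<Rightarrow> complex poly \<Rightarrow> sphere \<Rightarrow> sphere" where
  "rat_map P Q x =
     (case x of
        Some z \<Rightarrow> if poly Q z = 0 then None else Some (poly P z / poly Q z)
      | None \<Rightarrow>
          (let n = max (degree P) (degree Q)
           in if coeff Q n = 0 then None else Some (coeff P n / coeff Q n)))"

definition Rat_maps :: "(sphere \<Rightarrow> sphere) set" where
  "Rat_maps = {rat_map P Q | P Q. coprime P Q}"

definition poly_map :: "complex poly \<Rightarrow> sphere \<Rightarrow> sphere" where
  "poly_map P = rat_map P 1"

lemma poly_map_Some [simp]: "poly_map P (Some z) = Some (poly P z)"
  by (simp add: poly_map_def rat_map_def)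

lemma poly_map_None: "poly_map P None = (if degree P = 0 then Some (coeff P 0) else None)"
  by (simp add: poly_map_def rat_map_def)

lemma poly_map_in_Rat_maps: "poly_map P \<in> Rat_maps"
  unfolding poly_map_def Rat_maps_def using coprime_1_right by blast

lemma inj_poly_map: "inj poly_map"
proof (rule injI)
  fix P Q assume "poly_map P = poly_map Q"
  then have "Some (poly P z) = Some (poly Q z)" for z
    by (metis poly_map_Some)
  then have "poly P = poly Q" by auto
  then show "P = Q" by (simp add: poly_eq_poly_eq_iff)
qed

lemma poly_map_pcompose: "poly_map (pcompose P Q) = poly_map P \<circ> poly_map Q"
proof
  fix x show "poly_map (pcompose P Q) x = (poly_map P \<circ> poly_map Q) x"
  proof (cases x)
    case None
    show ?thesis
    proof (cases "degree Q = 0")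
      case True
      then obtain c where "Q = [:c:]" by (metis degree_eq_zeroE)
      have "pcompose P [:c:] = [:poly P c:]" by (induction P) (auto simp: pcompose_pCons)
      then show ?thesis using None \<open>Q = [:c:]\<close> by (simp add: poly_map_None)
    next
      case False
      then show ?thesis using None
        by (cases "degree P = 0") (auto simp: poly_map_None degree_pcompose pcompose_const elim: degree_eq_zeroE)
    qed
  qed (simp add: poly_pcompose)
qed

text \<open>The topological space \<^term>\<open>sphere_top\<close> has carrier \<^term>\<open>UNIV\<close>, so the functional
  equation below is an equality of maps on the whole sphere.\<close>

definition hurwitz_class :: "(sphere \<Rightarrow> sphere) \<Rightarrow> (sphere \<Rightarrow> sphere) set" where
  "hurwitz_class R =
     {Q \<in> Rat_maps. \<exists>\<phi> \<psi>. homeomorphic_map sphere_top sphere_top \<phi> \<and>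
        homeomorphic_map sphere_top sphere_top \<psi> \<and> Q \<circ> \<phi> = \<psi> \<circ> R}"


section \<open>Multiplicative characters\<close>

definition mult_character :: "'a set \<Rightarrow> ('a \<Rightarrow> 'a \<Rightarrow> 'a) \<Rightarrow> ('a \<Rightarrow> complex) \<Rightarrow> bool" where
  "mult_character S f \<phi> \<longleftrightarrow> (\<forall>s\<in>S. \<forall>t\<in>S. \<phi> (f s t) = \<phi> s * \<phi> t)"

text \<open>All constant polynomials, including \<open>0\<close>, have degree \<open>0\<close>.\<close>

definition elementary_character :: "(complex poly \<Rightarrow> complex) \<Rightarrow> bool" where
  "elementary_character \<phi> \<longleftrightarrow>
     (\<exists>f :: nat \<Rightarrow> complex. (\<forall>n m. f (n * m) = f n * f m) \<and> (\<forall>P. \<phi> P = f (degree P)))"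


section \<open>Prime decompositions under composition\<close>

definition comp_prime :: "complex poly \<Rightarrow> bool" where
  "comp_prime P \<longleftrightarrow> degree P > 0 \<and>
     (\<forall>Q R. P = pcompose Q R \<longrightarrow> degree Q = 1 \<or> degree R = 1)"

text \<open>The polynomial \<open>[:0, 1:]\<close> is the identity \<open>z\<close>, so the fold is \<open>P\<^sub>1 \<circ> \<dots> \<circ> P\<^sub>n\<close>.\<close>

definition prime_decomposition :: "complex poly \<Rightarrow> complex poly list \<Rightarrow> bool" where
  "prime_decomposition P Ps \<longleftrightarrow>
     Ps \<noteq> [] \<and> (\<forall>Q\<in>set Ps. comp_prime Q) \<and> P = foldr pcompose Ps [:0, 1:]"


section \<open>The character\<close>

definition phi1_prime :: "nat \<Rightarrow> complex poly \<Rightarrow> complex" where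
  "phi1_prime p P =
     (if poly_map P \<in> hurwitz_class (poly_map (monom 1 p)) then of_nat p else 1)"

definition phi1_value :: "nat \<Rightarrow> complex poly \<Rightarrow> complex \<Rightarrow> bool" where
  "phi1_value p P v \<longleftrightarrow>
     (\<exists>Ps. prime_decomposition P Ps \<and> v = prod_list (map (phi1_prime p) Ps))"

text \<open>The definite description makes sense only if \<^const>\<open>phi1_value\<close> determines exactly one
  value for each nonconstant polynomial. A prime \<open>P\<close> has the decomposition \<open>[P]\<close>, so the value
  at \<open>P\<close> is then \<open>phi1_prime p P\<close>.\<close>

definition phi1 :: "nat \<Rightarrow> complex poly \<Rightarrow> complex" where
  "phi1 p P = (if degree P = 0 then 0 else (THE v. phi1_value p P v))"

end

theory Submission
  imports Defs "HOL-Computational_Algebra.Field_as_Ring"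
begin

text \<open>A fibre count shows that a polynomial lies in the Hurwitz class of \<open>z\<^sup>p\<close> only if it is
  \<open>a(z - b)\<^sup>p + c\<close>. That the number of such factors does not depend on the prime decomposition is a
  weak form of Ritt's theorems. Let \<open>P = F \<circ> B = G \<circ> D\<close> with \<open>B\<close> and \<open>D\<close> prime. By a polynomial
  version of Lueroth's theorem \<open>B\<close> and \<open>D\<close> have a common right factor of degree
  \<open>gcd(deg B, deg D)\<close>, and by comparing approximate roots they have a common left multiple
  \<open>A \<circ> B = C \<circ> D\<close> of degree \<open>lcm(deg B, deg D)\<close> through which \<open>P\<close> factors. So either \<open>B\<close> and \<open>D\<close> agree
  up to a linear factor, or the degrees are coprime, \<open>A\<close> and \<open>C\<close> are prime, and \<open>A\<close> is equivalent to
  \<open>z\<^sup>p\<close> exactly if \<open>D\<close> is, and \<open>C\<close> exactly if \<open>B\<close> is; induct on the degree.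

  The Chebyshev polynomial \<open>T\<close> of degree \<open>p\<close> has value \<open>1\<close> and \<open>z\<^sup>p\<close> has value \<open>p\<close>. With
  \<open>J = z + 1/z\<close>, the identity \<open>T \<circ> J = J \<circ> z\<^sup>p\<close> forces an extension to vanish at \<open>J\<close>, but \<open>J\<close> is
  Moebius equivalent to \<open>z\<^sup>2\<close>, where the value is \<open>1\<close>.\<close>

section \<open>Common left multiples and approximate roots\<close>

lemma pcompose_right_cancel:
  fixes F G B :: "complex poly"
  assumes "pcompose F B = pcompose G B" "degree B > 0"
  shows "F = G"
proof -
  have "pcompose (F - G) B = 0" using assms by (simp add: pcompose_diff)
  then show ?thesis using assms(2) pcompose_eq_0 by fastforce
qed

lemma pcompose_power:
  fixes P Q :: "complex poly"
  shows "pcompose (P ^ n) Q = pcompose P Q ^ n"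
  by (induction n) (simp_all add: pcompose_mult pcompose_1)

text \<open>The sum is the cofactor of \<open>X - Y\<close> in \<open>X ^ m - Y ^ m\<close>. Its
  \<open>m\<close> summands share the degree and the leading coefficient, so in characteristic zero
  nothing cancels at the top.\<close>

lemma degree_sum_powers:
  fixes X Y :: "complex poly"
  assumes "degree X = n" "degree Y = n" "lead_coeff X = l" "lead_coeff Y = l" "l \<noteq> 0" "m \<ge> 1"
  defines "S \<equiv> (\<Sum>i<m. Y ^ (m - Suc i) * X ^ i)"
  shows "degree S = n * (m - 1)" "lead_coeff S = of_nat m * l ^ (m - 1)"
proof -
  have nz: "X \<noteq> 0" "Y \<noteq> 0" using assms by auto
  have d: "degree (Y ^ (m - Suc i) * X ^ i) = n * (m - 1)"
    and c: "lead_coeff (Y ^ (m - Suc i) * X ^ i) = l ^ (m - 1)" if "i < m" for i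
  proof -
    have m: "m - 1 = (m - Suc i) + i" using that by simp
    show "degree (Y ^ (m - Suc i) * X ^ i) = n * (m - 1)"
      using nz assms unfolding m by (simp add: degree_mult_eq degree_power_eq algebra_simps)
    show "lead_coeff (Y ^ (m - Suc i) * X ^ i) = l ^ (m - 1)"
      using nz assms unfolding m by (simp add: lead_coeff_mult lead_coeff_power power_add)
  qed
  have le: "degree S \<le> n * (m - 1)"
    unfolding S_def by (rule degree_sum_le) (use d in auto)
  have "coeff S (n * (m - 1)) = (\<Sum>i<m. l ^ (m - 1))"
    unfolding S_def coeff_sum by (rule sum.cong[OF refl]) (use c d in force)
  then have co: "coeff S (n * (m - 1)) = of_nat m * l ^ (m - 1)" by simp
  moreover have "of_nat m * l ^ (m - 1) \<noteq> 0" using assms by simp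
  ultimately show "degree S = n * (m - 1)" using le le_degree by (metis le_antisym)
  then show "lead_coeff S = of_nat m * l ^ (m - 1)" using co by simp
qed

text \<open>Uniqueness of approximate roots: if \<open>X - Y\<close> were nonzero, the cofactor
  alone would give \<open>X ^ m - Y ^ m\<close> degree at least \<open>n * (m - 1)\<close>.\<close>

lemma eq_if_degree_power_diff_small:
  fixes X Y :: "complex poly"
  assumes "degree X = n" "degree Y = n" "lead_coeff X = lead_coeff Y" "X \<noteq> 0" "m \<ge> 1"
    and "\<And>i. i \<ge> n * (m - 1) \<Longrightarrow> coeff (X ^ m - Y ^ m) i = 0"
  shows "X = Y"
proof (rule ccontr)
  assume ne: "X \<noteq> Y"
  define S where "S = (\<Sum>i<m. Y ^ (m - Suc i) * X ^ i)"
  have S: "degree S = n * (m - 1)" "lead_coeff S = of_nat m * lead_coeff X ^ (m - 1)"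
    unfolding S_def using degree_sum_powers[of X n Y "lead_coeff X" m] assms(1-5)
    by (metis leading_coeff_0_iff)+
  have "S \<noteq> 0" using S(2) assms by auto
  have eq: "X ^ m - Y ^ m = (X - Y) * S" unfolding S_def by (rule power_diff_sumr2)
  have "degree (X ^ m - Y ^ m) = degree (X - Y) + n * (m - 1)"
    unfolding eq using ne \<open>S \<noteq> 0\<close> S by (simp add: degree_mult_eq)
  then have "coeff (X ^ m - Y ^ m) (degree (X ^ m - Y ^ m)) = 0" using assms(6) by simp
  then have "X ^ m - Y ^ m = 0" by (simp only: leading_coeff_0_iff)
  then show False unfolding eq using ne \<open>S \<noteq> 0\<close> by simp
qed

text \<open>The coefficients of \<open>H\<close> are found from the top down. Adding a monomial of
  degree \<open>t < k\<close> to \<open>H\<close> changes \<open>H ^ m\<close> in degree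
  \<open>k * (m - 1) + t\<close> by a nonzero multiple of the new coefficient, and nowhere
  above.\<close>

lemma approximate_root:
  fixes F :: "complex poly"
  assumes deg: "degree F = m * k" and "m \<ge> 1" "k \<ge> 1" and lam: "l ^ m = lead_coeff F" "F \<noteq> 0"
  shows "\<exists>H. degree H = k \<and> lead_coeff H = l \<and> (\<forall>i \<ge> k * (m - 1). coeff (F - H ^ m) i = 0)"
proof -
  have lnz: "l \<noteq> 0" using lam \<open>m \<ge> 1\<close> by (auto simp: power_0_left)
  \<comment> \<open>Stage \<open>j\<close> has matched the coefficients in degrees down to
    \<open>m * k - j\<close>; the sum \<open>i + j\<close> avoids truncated subtraction.\<close>
  have "\<exists>H. degree H = k \<and> lead_coeff H = l \<and> (\<forall>i. i + j \<ge> m * k \<longrightarrow> coeff (F - H ^ m) i = 0)"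
    if "j \<le> k" for j using that
  proof (induction j)
    case 0
    have *: "coeff (F - monom l k ^ m) i = 0" if "i \<ge> m * k" for i
    proof -
      have "monom l k ^ m = monom (l ^ m) (m * k)" by (simp add: monom_power mult.commute)
      then show ?thesis using that deg lam by (cases "i = m * k") (auto simp: coeff_eq_0)
    qed
    show ?case using lnz * by (intro exI[of _ "monom l k"]) (auto simp: degree_monom_eq)
  next
    case (Suc j)
    then obtain H where H: "degree H = k" "lead_coeff H = l"
      and Hc: "\<And>i. i + j \<ge> m * k \<Longrightarrow> coeff (F - H ^ m) i = 0" by auto
    define t where "t = k - Suc j"
    define i0 where "i0 = k * (m - 1) + t"
    have mk: "m * k = k * (m - 1) + k" using \<open>m \<ge> 1\<close> by (cases m) auto
    have i0: "m * k = i0 + Suc j" using Suc.prems mk unfolding i0_def t_def by simp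
    \<comment> \<open>The denominator is the leading coefficient of the cofactor \<open>S\<close>
      below, so that \<open>monom e t * S\<close> cancels the error in degree
      \<open>i0\<close>.\<close>
    define e where "e = coeff (F - H ^ m) i0 / (of_nat m * l ^ (m - 1))"
    define H1 where "H1 = H + monom e t"
    have tk: "t < k" using Suc.prems unfolding t_def by simp
    have degm: "degree (monom e t) < degree H" using degree_monom_le[of e t] tk H(1) by linarith
    have "degree H1 = k" unfolding H1_def using degree_add_eq_left[OF degm] H(1) by simp
    moreover have "coeff H1 k = l" unfolding H1_def using H tk by auto
    ultimately have H1: "degree H1 = k" "lead_coeff H1 = l" by simp_all
    define S where "S = (\<Sum>i<m. H ^ (m - Suc i) * H1 ^ i)"
    have S: "degree S = k * (m - 1)" "lead_coeff S = of_nat m * l ^ (m - 1)"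
      unfolding S_def using degree_sum_powers[of H1 k H l m] H H1 lnz \<open>m \<ge> 1\<close> by auto
    have eq: "H1 ^ m - H ^ m = monom e t * S"
      unfolding S_def using power_diff_sumr2[of H1 m H] by (simp add: H1_def)
    have "coeff (F - H1 ^ m) i = 0" if i: "i + Suc j \<ge> m * k" for i
    proof -
      have e1: "coeff (F - H1 ^ m) i = coeff (F - H ^ m) i - coeff (monom e t * S) i"
        unfolding eq[symmetric] by simp
      have ii: "i \<ge> i0" using i i0 by simp
      have e2: "coeff (monom e t * S) i = e * coeff S (i - t)"
        using ii unfolding i0_def by (simp add: coeff_monom_mult)
      show ?thesis
      proof (cases "i = i0")
        case True
        have "i - t = degree S" using True S unfolding i0_def by simp
        then have "e * coeff S (i - t) = e * (of_nat m * l ^ (m - 1))" using S(2) by simp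
        also have "\<dots> = coeff (F - H ^ m) i0" unfolding e_def using lnz \<open>m \<ge> 1\<close> by simp
        finally show ?thesis unfolding e1 e2 using True by simp
      next
        case False
        then have gt: "i > i0" using ii by simp
        then have "i - t > degree S" using S unfolding i0_def by simp
        then have "coeff S (i - t) = 0" by (rule coeff_eq_0)
        moreover have "coeff (F - H ^ m) i = 0" using Hc gt i0 by simp
        ultimately show ?thesis unfolding e1 e2 by simp
      qed
    qed
    then show ?case using H1 by blast
  qed
  from this[of k] obtain H where "degree H = k" "lead_coeff H = l" 
    "\<And>i. i + k \<ge> m * k \<Longrightarrow> coeff (F - H ^ m) i = 0" by auto
  moreover have "m * k \<le> i + k" if "i \<ge> k * (m - 1)" for i using that by (cases m) (auto simp: mult.commute)
  ultimately show ?thesis by blast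
qed

text \<open>Stated by vanishing coefficients instead of degrees, so that the bound
  \<open>k = 0\<close> expresses \<open>F = 0\<close>; this occurs for approximate first
  roots.\<close>

lemma coeff_pcompose_eq_0:
  fixes F f :: "complex poly"
  assumes "\<And>i. i \<ge> k \<Longrightarrow> coeff F i = 0" "degree f > 0" "i \<ge> k * degree f"
  shows "coeff (pcompose F f) i = 0"
proof (cases "F = 0")
  case False
  then have "degree F < k" using assms(1) by (metis leading_coeff_0_iff not_le)
  then have "degree (pcompose F f) < i" using assms unfolding degree_pcompose
    by (metis less_le_trans mult_less_mono1)
  then show ?thesis by (rule coeff_eq_0)
qed simp

lemma complex_root_exists:
  fixes c :: complex assumes "m \<ge> 1" shows "\<exists>k. k ^ m = c"
proof (cases "c = 0")
  case True then show ?thesis using assms by (intro exI[of _ 0]) auto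
next
  case False
  then have "card {z::complex. z ^ m = c} = m" using card_nth_roots assms by simp
  then have "{z::complex. z ^ m = c} \<noteq> {}" using assms by (metis card.empty not_one_le_zero)
  then show ?thesis by blast
qed

text \<open>With \<open>m\<close> the quotient of \<open>degree P\<close> by the lcm, an approximate
  \<open>m\<close>-th root of \<open>F\<close> composed with \<open>f\<close> is one of
  \<open>P\<close>, and likewise for \<open>G\<close> and \<open>g\<close>. Uniqueness identifies
  the two.\<close>

lemma common_left_multiple_lcm:
  fixes F f G g :: "complex poly"
  assumes eq: "pcompose F f = pcompose G g" and pos: "degree (pcompose F f) > 0"
  shows "\<exists>A C. pcompose A f = pcompose C g \<and> degree (pcompose A f) = lcm (degree f) (degree g)"
proof -
  define P where "P = pcompose F f"
  have d: "degree P = degree F * degree f" "degree P = degree G * degree g"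
    unfolding P_def using degree_pcompose eq by metis+
  have p: "degree F > 0" "degree f > 0" "degree G > 0" "degree g > 0"
    using pos d unfolding P_def[symmetric] by (metis gr0I mult_is_0 less_irrefl)+
  define L where "L = lcm (degree f) (degree g)"
  have "L > 0" unfolding L_def using p lcm_pos_nat by blast
  have "L dvd degree P" unfolding L_def using d by (metis dvd_triv_right lcm_least)
  then obtain m where m: "degree P = m * L" by (metis dvd_div_mult_self)
  have "m \<ge> 1" using m pos unfolding P_def[symmetric] by (cases m) auto
  obtain k where k: "L = k * degree f" unfolding L_def by (metis dvd_div_mult_self dvd_lcm1)
  obtain k' where k': "L = k' * degree g" unfolding L_def by (metis dvd_div_mult_self dvd_lcm2)
  have kp: "k \<ge> 1" "k' \<ge> 1" using k k' \<open>L > 0\<close> by (auto simp: Suc_le_eq intro: Nat.gr0I)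
  \<comment> \<open>One root \<kappa> serves both sides: uniqueness requires equal leading
    coefficients, not just equal \<open>m\<close>-th powers of them.\<close>
  obtain \<kappa> where kap: "\<kappa> ^ m = lead_coeff P" using complex_root_exists \<open>m \<ge> 1\<close> by blast
  have "lead_coeff P \<noteq> 0" using pos P_def by auto
  have root: "\<exists>H. degree (pcompose H f) = L \<and> lead_coeff (pcompose H f) = \<kappa> \<and>
      (\<forall>i \<ge> L * (m - 1). coeff (P - pcompose H f ^ m) i = 0)"
    if P: "P = pcompose F f" and L: "L = k * degree f" and "k \<ge> 1" "degree f > 0" 
    for F f k
  proof -
    have dF: "degree F = m * k" using m that by (simp add: degree_pcompose)
    have fnz: "lead_coeff f \<noteq> 0" using that by auto
    have Fnz: "F \<noteq> 0" using P pos \<open>lead_coeff P \<noteq> 0\<close> by auto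
    have "lead_coeff P = lead_coeff F * (lead_coeff f) ^ (m * k)"
      unfolding P using lead_coeff_comp[OF \<open>degree f > 0\<close>] dF by metis
    then have "(\<kappa> / lead_coeff f ^ k) ^ m = lead_coeff F"
      using kap fnz by (simp add: power_divide power_mult[symmetric] mult.commute)
    from approximate_root[OF dF \<open>m \<ge> 1\<close> \<open>k \<ge> 1\<close> this Fnz]
    obtain H where H: "degree H = k" "lead_coeff H = \<kappa> / lead_coeff f ^ k"
       "\<And>i. i \<ge> k * (m - 1) \<Longrightarrow> coeff (F - H ^ m) i = 0" by blast
    have "degree (pcompose H f) = L" using H L by (simp add: degree_pcompose)
    moreover have "lead_coeff (pcompose H f) = \<kappa>"
      using lead_coeff_comp[OF \<open>degree f > 0\<close>, of H] H fnz by simp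
    moreover have "coeff (P - pcompose H f ^ m) i = 0" if "i \<ge> L * (m - 1)" for i
    proof -
      have "P - pcompose H f ^ m = pcompose (F - H ^ m) f"
        unfolding P by (simp add: pcompose_diff pcompose_power)
      moreover have "i \<ge> k * (m - 1) * degree f" using that L by (simp add: algebra_simps)
      ultimately show ?thesis using coeff_pcompose_eq_0[OF H(3) \<open>degree f > 0\<close>] by metis
    qed
    ultimately show ?thesis by blast
  qed
  obtain A where A: "degree (pcompose A f) = L" "lead_coeff (pcompose A f) = \<kappa>"
      "\<And>i. i \<ge> L * (m - 1) \<Longrightarrow> coeff (P - pcompose A f ^ m) i = 0"
    using root[OF P_def k kp(1) p(2)] by blast
  obtain C where C: "degree (pcompose C g) = L" "lead_coeff (pcompose C g) = \<kappa>"
      "\<And>i. i \<ge> L * (m - 1) \<Longrightarrow> coeff (P - pcompose C g ^ m) i = 0"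
    using root[OF P_def[unfolded eq] k' kp(2) p(4)] by blast
  have "pcompose A f = pcompose C g"
  proof (rule eq_if_degree_power_diff_small)
    show "pcompose A f \<noteq> 0" using A \<open>L > 0\<close> by auto
    show "coeff (pcompose A f ^ m - pcompose C g ^ m) i = 0" if "i \<ge> L * (m - 1)" for i
      using A(3)[OF that] C(3)[OF that] by simp
  qed (use A C \<open>m \<ge> 1\<close> in auto)
  then show ?thesis using A unfolding L_def by blast
qed

text \<open>Expansion in powers of \<open>E\<close>: the degree of \<open>P\<close> is a multiple of
  \<open>degree E\<close>, so a scalar multiple of a power of \<open>E\<close> removes the leading
  term, and the difference is again a polynomial both in \<open>f\<close> and in
  \<open>g\<close>.\<close>

lemma factor_through_lcm:
  fixes f g E A C :: "complex poly"
  assumes E: "E = pcompose A f" "E = pcompose C g" and L: "degree E = lcm (degree f) (degree g)"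
    and pos: "degree f > 0" "degree g > 0"
  shows "P = pcompose F f \<Longrightarrow> P = pcompose G g \<Longrightarrow> \<exists>H. P = pcompose H E"
proof (induction "degree P" arbitrary: P F G rule: less_induct)
  case less
  show ?case
  proof (cases "degree P = 0")
    case True
    then obtain c where "P = [:c:]" by (metis degree_eq_zeroE)
    then show ?thesis by (intro exI[of _ "[:c:]"]) simp
  next
    case False
    have "degree f dvd degree P" "degree g dvd degree P"
      using less.prems by (metis degree_pcompose dvd_triv_right)+
    then obtain j where j: "degree P = j * degree E"
      unfolding L by (metis dvd_div_mult_self lcm_least)
    have Ep: "degree E > 0" unfolding L using pos lcm_pos_nat by blast
    define c where "c = lead_coeff P / lead_coeff E ^ j"
    define P' where "P' = P - smult c (E ^ j)"
    have En: "E \<noteq> 0" using Ep by auto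
    have cn: "c \<noteq> 0" unfolding c_def using False En by auto
    have dd: "degree (smult c (E ^ j)) = degree P"
      using cn En j by (simp add: degree_power_eq)
    have "lead_coeff (smult c (E ^ j)) = lead_coeff P"
      unfolding c_def using En by (simp add: lead_coeff_power)
    then have "coeff P' (degree P) = 0" unfolding P'_def using dd by simp
    moreover have "degree P' \<le> degree P" unfolding P'_def using dd degree_diff_le by (metis order_refl)
    ultimately have lt: "degree P' < degree P" using False
      by (metis degree_0 gr0I leading_coeff_0_iff le_neq_implies_less)
    have "P' = pcompose (F - smult c (A ^ j)) f" "P' = pcompose (G - smult c (C ^ j)) g"
      unfolding P'_def using less.prems E by (simp_all add: pcompose_diff pcompose_smult pcompose_power)
    then obtain H where "P' = pcompose H E" using less.hyps[OF lt] by blast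
    then have "P = pcompose (H + smult c ([:0,1:] ^ j)) E"
      unfolding P'_def by (simp add: pcompose_add pcompose_smult pcompose_power pcompose_pCons algebra_simps)
    then show ?thesis by blast
  qed
qed

section \<open>Common right factors\<close>

lemma degree_diff_const:
  fixes h :: "complex poly"
  assumes "degree h > 0" shows "degree (h - [:c:]) = degree h" "h - [:c:] \<noteq> 0"
proof -
  show "degree (h - [:c:]) = degree h" using assms
    by (metis add_uminus_conv_diff degree_add_eq_left degree_minus degree_pCons_0)
  then show "h - [:c:] \<noteq> 0" using assms by auto
qed

section \<open>Bivariate polynomials specialised at a value of the inner variable\<close>

definition eval_coeffs :: "complex \<Rightarrow> complex poly poly \<Rightarrow> complex poly" where
  "eval_coeffs x Q = map_poly (\<lambda>c. poly c x) Q"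

lemma coeff_eval_coeffs [simp]: "coeff (eval_coeffs x Q) n = poly (coeff Q n) x"
  by (simp add: eval_coeffs_def coeff_map_poly)

lemma eval_coeffs_add [simp]: "eval_coeffs x (P + Q) = eval_coeffs x P + eval_coeffs x Q"
  by (rule poly_eqI) simp

lemma eval_coeffs_mult [simp]: "eval_coeffs x (P * Q) = eval_coeffs x P * eval_coeffs x Q"
  by (rule poly_eqI) (simp add: coeff_mult poly_sum)

lemma eval_coeffs_smult [simp]: "eval_coeffs x (smult c Q) = smult (poly c x) (eval_coeffs x Q)"
  by (rule poly_eqI) simp

lemma poly_poly_const: "poly (poly Q [:y:]) x = poly (eval_coeffs x Q) y"
proof -
  have "degree (eval_coeffs x Q) \<le> degree Q"
    by (rule degree_le) (simp add: coeff_eq_0)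
  then have "poly (eval_coeffs x Q) y = (\<Sum>i\<le>degree Q. coeff (eval_coeffs x Q) i * y ^ i)"
    unfolding poly_altdef by (intro sum.mono_neutral_left) (auto simp: coeff_eq_0 simp del: coeff_eval_coeffs)
  then show ?thesis by (simp add: poly_altdef[of Q] poly_sum)
qed

text \<open>This is \<open>f(Y) - f(x)\<close>, with \<open>Y\<close> the outer variable and
  \<open>x\<close> the inner one.\<close>

definition fibre_poly :: "complex poly \<Rightarrow> complex poly poly" where
  "fibre_poly f = map_poly (\<lambda>c. [:c:]) f - [:f:]"

lemma coeff_fibre_poly: "coeff (fibre_poly f) n = [:coeff f n:] - (if n = 0 then f else 0)"
  by (cases n) (simp_all add: fibre_poly_def coeff_map_poly)

lemma eval_fibre_poly [simp]: "eval_coeffs x (fibre_poly f) = f - [:poly f x:]"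
  by (rule poly_eqI) (simp add: coeff_fibre_poly coeff_pCons split: nat.splits)

lemma degree_fibre_poly:
  assumes "degree f > 0"
  shows "degree (fibre_poly f) = degree f" "lead_coeff (fibre_poly f) = [:lead_coeff f:]"
proof -
  have "degree (fibre_poly f) \<le> degree f"
    by (rule degree_le) (use assms in \<open>auto simp: coeff_fibre_poly coeff_eq_0\<close>)
  moreover have "coeff (fibre_poly f) (degree f) = [:lead_coeff f:]"
    using assms by (simp add: coeff_fibre_poly)
  moreover have "[:lead_coeff f:] \<noteq> 0" using assms by auto
  ultimately show "degree (fibre_poly f) = degree f" "lead_coeff (fibre_poly f) = [:lead_coeff f:]"
    by (metis le_antisym le_degree)+
qed

section \<open>Gauss's lemma and common divisors over the field of rational functions in
  \<open>x\<close>\<close>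

lemma primitive_dvd_smultD:
  fixes D F :: "complex poly poly"
  assumes "D dvd smult a F" "a \<noteq> 0" "content D = 1"
  shows "D dvd F"
proof (rule fract_poly_dvdD[OF _ assms(3)])
  have "fract_poly D dvd smult (to_fract a) (fract_poly F)"
    using fract_poly_dvd[OF assms(1)] by simp
  then show "fract_poly D dvd fract_poly F" using assms(2) by (simp add: dvd_smult_iff)
qed

text \<open>An element of least degree in the ideal divides every other one up to a nonzero factor
  from the coefficient ring, by pseudo-division. Its primitive part then divides exactly by Gauss's
  lemma, and its content becomes the factor \<open>c\<close> in the Bezout identity.\<close>

lemma primitive_common_divisor:
  fixes F1 F2 :: "complex poly poly"
  assumes "F1 \<noteq> 0"
  shows "\<exists>D u v c. D dvd F1 \<and> D dvd F2 \<and> c \<noteq> 0 \<and> smult c D = u * F1 + v * F2"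
proof -
  define I where "I = {Q. \<exists>u v. Q = u * F1 + v * F2}"
  have F: "F1 \<in> I" "F2 \<in> I" unfolding I_def
    by (auto intro: exI[of _ 1] exI[of _ 0])
  have "\<exists>Q. Q \<in> I \<and> Q \<noteq> 0" using F assms by blast
  then obtain Q where Q: "Q \<in> I" "Q \<noteq> 0"
    and min: "\<And>R. R \<in> I \<Longrightarrow> R \<noteq> 0 \<Longrightarrow> degree Q \<le> degree R"
    using ex_has_least_nat[of "\<lambda>Q. Q \<in> I \<and> Q \<noteq> 0" _ degree] by blast
  obtain u v where uv: "Q = u * F1 + v * F2" using Q unfolding I_def by blast
  define D where "D = primitive_part Q"
  have cD: "content D = 1" unfolding D_def using Q by simp
  have dvd: "D dvd F" if FI: "F \<in> I" for F
  proof -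
    obtain a W where aW: "a \<noteq> 0" "smult a F = Q * W + pseudo_mod F Q"
      using pseudo_mod(1)[OF Q(2)] by blast
    obtain u' v' where F': "F = u' * F1 + v' * F2" using FI unfolding I_def by blast
    have "pseudo_mod F Q = smult a F - Q * W" using aW by simp
    also have "\<dots> = (smult a u' - u * W) * F1 + (smult a v' - v * W) * F2"
      unfolding uv F' by (simp add: algebra_simps smult_add_right)
    finally have "pseudo_mod F Q \<in> I" unfolding I_def by blast
    then have "pseudo_mod F Q = 0" using min pseudo_mod(2)[OF Q(2), of F] by force
    then have "Q dvd smult a F" using aW by simp
    moreover have "D dvd Q" unfolding D_def
      by (metis content_times_primitive_part dvd_refl dvd_smult)
    ultimately show ?thesis using primitive_dvd_smultD aW(1) cD dvd_trans by blast
  qed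
  have "smult (content Q) D = u * F1 + v * F2" unfolding D_def using uv by simp
  moreover have "content Q \<noteq> 0" using Q by simp
  ultimately show ?thesis using dvd F by blast
qed

section \<open>Generic fibres and a polynomial Lueroth theorem\<close>

lemma finite_preimage_poly:
  fixes f :: "complex poly"
  assumes "degree f > 0" "finite Z"
  shows "finite {x. poly f x \<in> Z}"
proof -
  have "{x. poly f x \<in> Z} = (\<Union>z\<in>Z. {x. poly (f - [:z:]) x = 0})" by auto
  moreover have "finite {x. poly (f - [:z:]) x = 0}" for z
    by (rule poly_roots_finite) (use assms in auto)
  ultimately show ?thesis using assms(2) by simp
qed

lemma card_roots_rsquarefree:
  fixes f :: "complex poly"
  assumes "f \<noteq> 0" "\<And>z. poly f z = 0 \<Longrightarrow> poly (pderiv f) z \<noteq> 0"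
  shows "card {z. poly f z = 0} = degree f"
proof -
  have "rsquarefree f" unfolding rsquarefree_roots using assms by blast
  then have "f = smult (lead_coeff f) (\<Prod>z|poly f z = 0. [:-z, 1:])"
    using complex_poly_decompose_rsquarefree by metis
  then have "degree f = degree (\<Prod>z|poly f z = 0. [:-z, 1:])"
    using assms by (metis degree_smult_eq leading_coeff_0_iff)
  also have "\<dots> = card {z. poly f z = 0}"
    by (subst degree_prod_sum_eq) auto
  finally show ?thesis by simp
qed

lemma dvd_simple_roots:
  fixes D F :: "complex poly"
  assumes "D dvd F" "\<And>z. poly F z = 0 \<Longrightarrow> poly (pderiv F) z \<noteq> 0" "poly D z = 0"
  shows "poly (pderiv D) z \<noteq> 0"
proof
  assume *: "poly (pderiv D) z = 0"
  obtain W where "F = D * W" using assms by blast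
  then have "poly F z = 0" "poly (pderiv F) z = 0" using assms * by (auto simp: pderiv_mult)
  then show False using assms by blast
qed

text \<open>\<open>D\<close> below is the gcd of \<open>f(Y) - f(x)\<close> and \<open>g(Y) - g(x)\<close> over \<open>\<complex>(x)\<close>. For generic \<open>x\<close> its
  roots are the points that neither \<open>f\<close> nor \<open>g\<close> separates from \<open>x\<close>, so its coefficients are
  functions with the same fibres, and a nonconstant one generates.\<close>

lemma common_fibre_function:
  fixes f g :: "complex poly"
  assumes f: "degree f > 0" and g: "degree g > 0"
  shows "\<exists>h Z. degree h > 0 \<and> finite Z \<and> 
    (\<forall>x. x \<notin> Z \<longrightarrow> (\<forall>y. poly f y = poly f x \<longrightarrow> y \<notin> Z) \<and>
        card {y. poly f y = poly f x} = degree f \<and>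
        {y. poly f y = poly f x \<and> poly g y = poly g x} = {y. poly h y = poly h x} \<and> 
        card {y. poly h y = poly h x} = degree h)"
proof -
  have Fn: "fibre_poly f \<noteq> 0" using degree_fibre_poly(1)[OF f] f by auto
  from primitive_common_divisor[OF Fn, of "fibre_poly g"]
  obtain D u v c where D: "D dvd fibre_poly f" "D dvd fibre_poly g" and c: "c \<noteq> 0"
    and uv: "smult c D = u * fibre_poly f + v * fibre_poly g" by blast
  obtain W where W: "fibre_poly f = D * W" using D by blast
  obtain W' where W': "fibre_poly g = D * W'" using D by blast
  define \<delta> where "\<delta> = degree D"
  \<comment> \<open>A constant leading coefficient keeps the degree in \<open>Y\<close> from
    dropping when \<open>x\<close> is specialised.\<close>
  have "lead_coeff D dvd [:lead_coeff f:]"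
    using W degree_fibre_poly(2)[OF f] by (metis dvd_triv_left lead_coeff_mult)
  moreover have "is_unit [:lead_coeff f:]" using f by (auto simp: is_unit_const_poly_iff dvd_field_iff)
  ultimately have "is_unit (lead_coeff D)" using dvd_trans by blast
  then obtain \<kappa> where kap: "lead_coeff D = [:\<kappa>:]" "\<kappa> \<noteq> 0"
    by (metis is_unit_const_poly_iff is_unit_polyE dvd_0_left_iff one_neq_zero)
  \<comment> \<open>The values of \<open>f\<close> at its critical points and at the roots of the
    Bezout factor \<open>c\<close>. The exceptional set \<open>Z\<close> consists of whole fibres of
    \<open>f\<close>, so a fibre through a generic point avoids it entirely.\<close>
  define bad where "bad = poly f ` ({y. poly (pderiv f) y = 0} \<union> {y. poly c y = 0})"
  have "pderiv f \<noteq> 0" using f by (simp add: pderiv_eq_0_iff)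
  then have "finite bad" unfolding bad_def using c poly_roots_finite by blast
  define Z where "Z = {x. poly f x \<in> bad}"
  have finZ: "finite Z" unfolding Z_def by (rule finite_preimage_poly[OF f \<open>finite bad\<close>])
  define Cl where "Cl = (\<lambda>x. {y. poly f y = poly f x \<and> poly g y = poly g x})"
  have simple: "poly (pderiv (f - [:poly f x:])) y \<noteq> 0" if "x \<notin> Z" "poly (f - [:poly f x:]) y = 0" for x y
  proof -
    have "poly f y \<notin> bad" using that unfolding Z_def by simp
    then have "poly (pderiv f) y \<noteq> 0" unfolding bad_def by blast
    then show ?thesis by (simp add: pderiv_diff pderiv_pCons)
  qed
  have fib: "poly f y = poly f x \<Longrightarrow> x \<notin> Z \<Longrightarrow> y \<notin> Z" for x y
    unfolding Z_def by simp
  have evD: "degree (eval_coeffs x D) = \<delta>" "lead_coeff (eval_coeffs x D) = \<kappa>" for x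
  proof -
    have le: "degree (eval_coeffs x D) \<le> \<delta>"
      by (rule degree_le) (auto simp: \<delta>_def coeff_eq_0)
    have co: "coeff (eval_coeffs x D) \<delta> = \<kappa>" using kap by (simp add: \<delta>_def)
    show "degree (eval_coeffs x D) = \<delta>" using le co kap(2) by (metis le_antisym le_degree)
    then show "lead_coeff (eval_coeffs x D) = \<kappa>" using co by simp
  qed
  have evnz: "eval_coeffs x D \<noteq> 0" for x using evD(2)[of x] kap(2) by (metis leading_coeff_0_iff)
  have Wx: "f - [:poly f x:] = eval_coeffs x D * eval_coeffs x W"
       "g - [:poly g x:] = eval_coeffs x D * eval_coeffs x W'" for x
    using arg_cong[OF W, of "eval_coeffs x"] arg_cong[OF W', of "eval_coeffs x"] by simp_all
  have sub: "poly f y = poly f x" "poly g y = poly g x" if "poly (eval_coeffs x D) y = 0" for x y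
    using arg_cong[OF Wx(1)[of x], of "\<lambda>p. poly p y"] arg_cong[OF Wx(2)[of x], of "\<lambda>p. poly p y"] that
    by simp_all
  \<comment> \<open>Where \<open>c\<close> does not vanish, the specialised Bezout identity makes
    every common root a root of \<open>D\<close>.\<close>
  have roots: "{y. poly (eval_coeffs x D) y = 0} = Cl x" if "x \<notin> Z" for x
  proof -
    have "poly (eval_coeffs x D) y = 0" if "y \<in> Cl x" for y
    proof -
      have "poly c x \<noteq> 0" using \<open>x \<notin> Z\<close> unfolding Z_def bad_def by auto
      moreover have "poly (eval_coeffs x (smult c D)) y = 0"
        unfolding uv using that unfolding Cl_def by simp
      ultimately show ?thesis by simp
    qed
    then show ?thesis using sub unfolding Cl_def by blast
  qed
  have simpleD: "poly (pderiv (eval_coeffs x D)) y \<noteq> 0"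
    if "x \<notin> Z" "poly (eval_coeffs x D) y = 0" for x y
    by (rule dvd_simple_roots[OF _ simple[OF that(1)] that(2)]) (use Wx(1) in \<open>metis dvd_triv_left\<close>)
  have cardCl: "card (Cl x) = \<delta>" if "x \<notin> Z" for x
    using card_roots_rsquarefree[OF evnz simpleD[OF that]] roots[OF that] evD(1) by simp
  \<comment> \<open>Both sides are squarefree with leading coefficient \<kappa> and the same
    roots.\<close>
  have ev_eq: "eval_coeffs y D = eval_coeffs x D" if "x \<notin> Z" "y \<in> Cl x" for x y
  proof -
    have y: "y \<notin> Z" using fib[of y x] that unfolding Cl_def by simp
    have "rsquarefree (eval_coeffs z D)" if "z \<notin> Z" for z
      unfolding rsquarefree_roots using simpleD[OF that] by blast
    then have "eval_coeffs z D = smult \<kappa> (\<Prod>z\<in>Cl z. [:-z, 1:])" if "z \<notin> Z" for z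
      using complex_poly_decompose_rsquarefree[of "eval_coeffs z D"] roots[OF that] evD(2) that
      by metis
    moreover have "Cl y = Cl x" using that unfolding Cl_def by auto
    ultimately show ?thesis using y that(1) by simp
  qed
  have infgood: "infinite (- Z)" using finZ by (simp add: Compl_eq_Diff_UNIV infinite_UNIV_char_0)
  \<comment> \<open>Otherwise one nonzero polynomial independent of \<open>x\<close> would vanish at
    every \<open>x\<close> outside \<open>Z\<close>, since \<open>x\<close> lies in its own
    class.\<close>
  have "\<exists>j. degree (coeff D j) > 0"
  proof (rule ccontr)
    assume "\<not> ?thesis"
    then have "poly (coeff D j) x = coeff (coeff D j) 0" for j x
      by (metis degree_eq_zeroE gr0I coeff_pCons_0 mult_zero_right poly_pCons add.right_neutral poly_0)
    then have e: "eval_coeffs x D = eval_coeffs 0 D" for x by (intro poly_eqI) simp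
    have "x \<in> {y. poly (eval_coeffs 0 D) y = 0}" if "x \<notin> Z" for x
      using roots[OF that] unfolding e[of x] Cl_def by blast
    then have "- Z \<subseteq> {y. poly (eval_coeffs 0 D) y = 0}" by auto
    then show False using infgood poly_roots_finite[OF evnz[of 0]] finite_subset by blast
  qed
  then obtain j where j: "degree (coeff D j) > 0" by blast
  define h where "h = coeff D j"
  have hCl: "poly h y = poly h x" if "x \<notin> Z" "y \<in> Cl x" for x y
    using arg_cong[OF ev_eq[OF that], of "\<lambda>p. coeff p j"] unfolding h_def by simp
  have finh: "finite {y. poly h y = poly h x}" for x
    using finite_preimage_poly[of h "{poly h x}"] j unfolding h_def by simp
  \<comment> \<open>The two variables are exchanged. For generic \<open>y\<close>, the polynomial
    \<open>E\<close> in \<open>x\<close> divides \<open>f - f(y)\<close> and has the class of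
    \<open>y\<close> as its simple roots, hence degree \<delta>. A coefficient of larger degree
    \<open>M\<close> would force \<open>degree E\<close> to be at least \<open>M\<close>.\<close>
  have degle: "degree (coeff D i) \<le> \<delta>" for i
  proof (rule ccontr)
    assume neg: "\<not> ?thesis"
    define M where "M = Max ((\<lambda>i. degree (coeff D i)) ` {..\<delta>})"
    have Mge: "degree (coeff D i) \<le> M" for i
    proof (cases "i \<le> \<delta>")
      case True then show ?thesis unfolding M_def by (intro Max_ge) auto
    next
      case False then show ?thesis unfolding \<delta>_def by (simp add: coeff_eq_0)
    qed
    then have "M > \<delta>" using neg by (metis not_le order_trans)
    have "M \<in> (\<lambda>i. degree (coeff D i)) ` {..\<delta>}" unfolding M_def by (rule Max_in) auto
    then obtain i0 where i0: "degree (coeff D i0) = M" by auto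
    \<comment> \<open>The coefficient of \<open>x^M\<close> in \<open>D\<close>, as a polynomial in
      \<open>Y\<close>; \<open>y\<close> is chosen off its roots.\<close>
    define top where "top = map_poly (\<lambda>q. coeff q M) D"
    have "coeff top i0 \<noteq> 0" unfolding top_def using i0 \<open>M > \<delta>\<close> by (auto simp: coeff_map_poly)
    then have "top \<noteq> 0" by auto
    then have "finite {y. poly top y = 0}" by (rule poly_roots_finite)
    then have "\<exists>y. y \<notin> Z \<and> poly top y \<noteq> 0" using infgood finZ
      by (metis (mono_tags, lifting) Compl_iff finite_subset mem_Collect_eq subsetI)
    then obtain y where y: "y \<notin> Z" "poly top y \<noteq> 0" by blast
    define E where "E = poly D [:y:]"
    have Ex: "poly E x = poly (eval_coeffs x D) y" for x
      unfolding E_def by (rule poly_poly_const)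
    have "coeff E M = poly top y"
    proof -
      have "degree top \<le> \<delta>" 
        by (rule degree_le) (simp add: top_def \<delta>_def coeff_map_poly coeff_eq_0)
      have "coeff E M = (\<Sum>i\<le>\<delta>. coeff (coeff D i * [:y:] ^ i) M)"
        unfolding E_def poly_altdef by (simp add: coeff_sum \<delta>_def)
      also have "\<dots> = (\<Sum>i\<le>\<delta>. coeff top i * y ^ i)"
        by (rule sum.cong[OF refl]) (simp add: top_def coeff_map_poly poly_const_pow mult.commute)
      also have "\<dots> = poly top y"
        unfolding poly_altdef by (rule sum.mono_neutral_right)
          (use \<open>degree top \<le> \<delta>\<close> in \<open>auto simp: coeff_eq_0\<close>)
      finally show ?thesis .
    qed
    then have "degree E \<ge> M" "E \<noteq> 0" using y(2) by (auto intro: le_degree)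
    have rE: "{x. poly E x = 0} = Cl y"
    proof (intro set_eqI iffI)
      fix x assume "x \<in> {x. poly E x = 0}"
      then show "x \<in> Cl y" using sub[of x y] unfolding Ex Cl_def by simp
    next
      fix x assume x: "x \<in> Cl y"
      then have "x \<notin> Z" using fib[of x y] y unfolding Cl_def by simp
      moreover have "y \<in> Cl x" using x unfolding Cl_def by simp
      ultimately show "x \<in> {x. poly E x = 0}" using roots unfolding Ex by blast
    qed
    have "E dvd f - [:poly f y:]"
    proof -
      \<comment> \<open>The sign comes from exchanging \<open>x\<close> and \<open>y\<close> in
        \<open>f(y) - f(x)\<close>.\<close>
      have "poly (f - [:poly f y:]) x = poly (E * (- poly W [:y:])) x" for x
        using arg_cong[OF Wx(1)[of x], of "\<lambda>p. poly p y"]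
        by (simp add: Ex poly_poly_const algebra_simps)
      then have "f - [:poly f y:] = E * (- poly W [:y:])"
        by (simp add: poly_eq_poly_eq_iff[symmetric] fun_eq_iff)
      then show ?thesis by simp
    qed
    then have "poly (pderiv E) z \<noteq> 0" if "poly E z = 0" for z
      using dvd_simple_roots[OF _ simple[OF y(1)]] that by blast
    then have "degree E = \<delta>"
      using card_roots_rsquarefree[OF \<open>E \<noteq> 0\<close>] rE cardCl[OF y(1)] by simp
    then show False using \<open>degree E \<ge> M\<close> \<open>M > \<delta>\<close> by simp
  qed
  \<comment> \<open>\<open>h\<close> is constant on the \<delta> points of a class and has degree at
    most \<delta>, so the class is a full fibre of \<open>h\<close>.\<close>
  have hroots: "Cl x = {y. poly h y = poly h x}" "degree h = \<delta>" if "x \<notin> Z" for x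
  proof -
    have sub: "Cl x \<subseteq> {y. poly h y = poly h x}" using hCl[OF that] by blast
    have hx: "degree (h - [:poly h x:]) = degree h" "h - [:poly h x:] \<noteq> 0"
      using degree_diff_const j unfolding h_def by blast+
    from card_poly_roots_bound[OF hx(2)]
    have "card {y. poly h y = poly h x} \<le> degree h" unfolding hx(1) by simp
    moreover have "\<delta> \<le> card {y. poly h y = poly h x}"
      using card_mono[OF finh sub] cardCl[OF that] by simp
    ultimately have "degree h = \<delta>" "card {y. poly h y = poly h x} = \<delta>"
      using degle[of j] unfolding h_def by auto
    then show "degree h = \<delta>" "Cl x = {y. poly h y = poly h x}"
      using card_subset_eq[OF finh sub] cardCl[OF that] by auto
  qed
  have cf: "card {y. poly f y = poly f x} = degree f" if "x \<notin> Z" for x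
  proof -
    have "f - [:poly f x:] \<noteq> 0" using degree_diff_const(2)[OF f] .
    from card_roots_rsquarefree[OF this simple[OF that]]
    have "card {z. poly f z = poly f x} = degree (f - [:poly f x:])" by simp
    also have "\<dots> = degree f" using degree_diff_const(1)[OF f] .
    finally show ?thesis .
  qed
  have "(\<forall>y. poly f y = poly f x \<longrightarrow> y \<notin> Z) \<and>
        card {y. poly f y = poly f x} = degree f \<and>
        {y. poly f y = poly f x \<and> poly g y = poly g x} = {y. poly h y = poly h x} \<and>
        card {y. poly h y = poly h x} = degree h" if x: "x \<notin> Z" for x
    using fib[of _ x] x hroots[OF x] cardCl[OF x] cf[OF x] by (simp add: Cl_def)
  moreover have "degree h > 0" using j unfolding h_def .
  ultimately show ?thesis using finZ by blast
qed

text \<open>Expansion in powers of \<open>h - h(x0)\<close>: modulo this polynomial \<open>u\<close>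
  leaves a remainder of degree below \<open>degree h\<close> that takes the value
  \<open>u(x0)\<close> at \<open>degree h\<close> points, hence a constant. The quotient is again
  constant on generic fibres.\<close>

lemma factor_through_fibres:
  fixes h :: "complex poly"
  assumes h: "degree h > 0" 
  shows "finite Z \<Longrightarrow> (\<And>x. x \<notin> Z \<Longrightarrow> card {y. poly h y = poly h x} = degree h) \<Longrightarrow>
    (\<And>x y. x \<notin> Z \<Longrightarrow> poly h y = poly h x \<Longrightarrow> poly u y = poly u x) \<Longrightarrow> \<exists>v. u = pcompose v h"
proof (induction "degree u" arbitrary: u Z rule: less_induct)
  case less
  have "infinite (- Z)" using less.prems(1) by (simp add: Compl_eq_Diff_UNIV infinite_UNIV_char_0)
  then obtain x0 where x0: "x0 \<notin> Z" by (metis ComplD finite.emptyI ex_in_conv)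
  define h0 where "h0 = h - [:poly h x0:]"
  have dh0: "degree h0 = degree h" unfolding h0_def using degree_diff_const(1)[OF h] .
  have h0: "h0 \<noteq> 0" using dh0 h by auto
  define q r where "q = u div h0" and "r = u mod h0"
  have u: "u = q * h0 + r" unfolding q_def r_def by simp
  have "r - [:poly u x0:] = 0"
  proof (rule ccontr)
    assume ne: "r - [:poly u x0:] \<noteq> 0"
    have "degree r < degree h" using degree_mod_less[OF h0, of u] h dh0 unfolding r_def by auto
    then have "degree (r - [:poly u x0:]) < degree h" using h by (simp add: degree_diff_less)
    moreover have "{y. poly h y = poly h x0} \<subseteq> {y. poly (r - [:poly u x0:]) y = 0}"
    proof
      fix y assume "y \<in> {y. poly h y = poly h x0}"
      then have y: "poly h y = poly h x0" by simp
      then have "poly u y = poly r y" using u unfolding h0_def by simp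
      then show "y \<in> {y. poly (r - [:poly u x0:]) y = 0}" using less.prems(3)[OF x0 y] by simp
    qed
    then have "degree h \<le> card {y. poly (r - [:poly u x0:]) y = 0}"
      using card_mono[OF poly_roots_finite[OF ne]] less.prems(2)[OF x0] by metis
    ultimately show False using card_poly_roots_bound[OF ne] by simp
  qed
  then have u': "u = q * h0 + [:poly u x0:]" using u by simp
  show ?case
  proof (cases "q = 0")
    case True
    then show ?thesis using u' by (metis add_0 mult_zero_left pcompose_const)
  next
    case False
    \<comment> \<open>Removing the fibre through \<open>x0\<close> allows the factor
      \<open>h(x) - h(x0)\<close> to be cancelled.\<close>
    define Z' where "Z' = Z \<union> {x. poly h x \<in> {poly h x0}}"
    have "degree (q * h0) > 0" using False h0 dh0 h by (simp add: degree_mult_eq)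
    then have "degree u = degree (q * h0)" using u' 
      by (metis degree_add_eq_left degree_pCons_0)
    then have lt: "degree q < degree u" using False h0 dh0 h by (simp add: degree_mult_eq)
    have fin: "finite Z'" unfolding Z'_def using less.prems(1) finite_preimage_poly[OF h, of "{poly h x0}"] by simp
    have "\<exists>v. q = pcompose v h"
    proof (rule less.hyps[OF lt fin])
      show "card {y. poly h y = poly h x} = degree h" if "x \<notin> Z'" for x
        using that less.prems(2) unfolding Z'_def by simp
      show "poly q y = poly q x" if x: "x \<notin> Z'" and y: "poly h y = poly h x" for x y
      proof -
        have "poly u y = poly u x" using less.prems(3)[of x y] x y unfolding Z'_def by simp
        moreover have "poly u z = poly q z * (poly h z - poly h x0) + poly u x0" for z
          using arg_cong[OF u', of "\<lambda>p. poly p z"] unfolding h0_def by simp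
        ultimately have "poly q y * (poly h x - poly h x0) = poly q x * (poly h x - poly h x0)"
          using y by (metis add_right_cancel)
        then show ?thesis using x unfolding Z'_def by simp
      qed
    qed
    then obtain v where "q = pcompose v h" by blast
    then have "u = pcompose (v * [:- poly h x0, 1:] + [:poly u x0:]) h"
      using u' unfolding h0_def
      by (simp only: pcompose_add pcompose_mult pcompose_const)
        (simp add: pcompose_pCons algebra_simps flip: minus_pCons)
    then show ?thesis by blast
  qed
qed

text \<open>The fibre counts are kept next to the factorisations because they bound the degree of
  \<open>h\<close> from below in \<open>common_right_factor_gcd\<close>.\<close>

lemma polynomial_luroth:
  fixes f g :: "complex poly"
  assumes f: "degree f > 0" and g: "degree g > 0"
  shows "\<exists>h Z u v. f = pcompose u h \<and> g = pcompose v h \<and> degree h > 0 \<and> finite Z \<and> 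
    (\<forall>x. x \<notin> Z \<longrightarrow> (\<forall>y. poly f y = poly f x \<longrightarrow> y \<notin> Z) \<and>
        card {y. poly f y = poly f x} = degree f \<and>
        card {y. poly f y = poly f x \<and> poly g y = poly g x} = degree h)"
proof -
  from common_fibre_function[OF assms] obtain h Z where h: "degree h > 0" and Z: "finite Z"
    and P: "\<And>x. x \<notin> Z \<Longrightarrow> (\<forall>y. poly f y = poly f x \<longrightarrow> y \<notin> Z) \<and>
        card {y. poly f y = poly f x} = degree f \<and>
        {y. poly f y = poly f x \<and> poly g y = poly g x} = {y. poly h y = poly h x} \<and> 
        card {y. poly h y = poly h x} = degree h" by blast
  have "\<exists>u. f = pcompose u h"
    by (rule factor_through_fibres[OF h Z]) (use P in blast)+
  moreover have "\<exists>u. g = pcompose u h"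
    by (rule factor_through_fibres[OF h Z]) (use P in blast)+
  ultimately obtain u v where "f = pcompose u h" "g = pcompose v h" by blast
  moreover have "\<forall>x. x \<notin> Z \<longrightarrow> (\<forall>y. poly f y = poly f x \<longrightarrow> y \<notin> Z) \<and>
        card {y. poly f y = poly f x} = degree f \<and>
        card {y. poly f y = poly f x \<and> poly g y = poly g x} = degree h"
    using P by simp
  ultimately show ?thesis using h Z by blast
qed

text \<open>Let \<open>A\<close> and \<open>C\<close> complete \<open>f\<close> and \<open>g\<close>
  to a common multiple of degree lcm, so \<open>degree C\<close> is \<open>degree f\<close> divided
  by the gcd. On a generic fibre of \<open>f\<close>, \<open>g\<close> takes only roots of a
  translate of \<open>C\<close> as values, each exactly \<open>degree h\<close> times. Hence
  \<open>degree f\<close> is at most \<open>degree C * degree h\<close>, and \<open>degree h\<close>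
  is at least the gcd.\<close>

lemma common_right_factor_gcd:
  fixes F f G g :: "complex poly"
  assumes eq: "pcompose F f = pcompose G g" and pos: "degree (pcompose F f) > 0"
  shows "\<exists>h u v. f = pcompose u h \<and> g = pcompose v h \<and> degree h = gcd (degree f) (degree g)"
proof -
  have p: "degree f > 0" "degree g > 0"
    using pos eq by (metis degree_pcompose gr0I less_irrefl mult_0_right)+
  obtain A C where AC: "pcompose A f = pcompose C g" and dA: "degree (pcompose A f) = lcm (degree f) (degree g)"
    using common_left_multiple_lcm[OF assms] by blast
  have "degree C * degree g = lcm (degree f) (degree g)" using AC dA by (metis degree_pcompose)
  then have "degree C * degree g * gcd (degree f) (degree g) = degree f * degree g"
    by (metis mult.commute prod_gcd_lcm_nat)
  then have dC: "degree C * gcd (degree f) (degree g) = degree f" using p(2)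
    by (metis mult.assoc mult.commute mult_right_cancel less_irrefl)
  then have Cpos: "degree C > 0" using p(1) by (metis gr0I less_irrefl mult_0)
  from polynomial_luroth[OF p] obtain h Z u v where
    huv: "f = pcompose u h" "g = pcompose v h" and h: "degree h > 0" and Z: "finite Z"
    and fib: "\<And>x y. x \<notin> Z \<Longrightarrow> poly f y = poly f x \<Longrightarrow> y \<notin> Z"
    and cf: "\<And>x. x \<notin> Z \<Longrightarrow> card {y. poly f y = poly f x} = degree f"
    and ch: "\<And>x. x \<notin> Z \<Longrightarrow> card {y. poly f y = poly f x \<and> poly g y = poly g x} = degree h"
    by blast
  have "infinite (- Z)" using Z by (simp add: Compl_eq_Diff_UNIV infinite_UNIV_char_0)
  then obtain x where x: "x \<notin> Z" by (metis ComplD finite.emptyI ex_in_conv)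
  define Fb where "Fb = {y. poly f y = poly f x}"
  have finFb: "finite Fb" unfolding Fb_def using finite_preimage_poly[OF p(1), of "{poly f x}"] by simp
  define C' where "C' = C - [:poly A (poly f x):]"
  have C': "C' \<noteq> 0" "degree C' = degree C" 
    using degree_diff_const[OF Cpos] unfolding C'_def by blast+
  have img: "poly g ` Fb \<subseteq> {w. poly C' w = 0}"
  proof (rule image_subsetI)
    fix y assume "y \<in> Fb"
    have "poly C (poly g y) = poly A (poly f y)" using AC by (metis poly_pcompose)
    then show "poly g y \<in> {w. poly C' w = 0}" using \<open>y \<in> Fb\<close> unfolding C'_def Fb_def by simp
  qed
  have "card (poly g ` Fb) \<le> degree C"
    using card_mono[OF poly_roots_finite[OF C'(1)] img] card_poly_roots_bound[OF C'(1)] C'(2) by simp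
  moreover have "degree f = card (poly g ` Fb) * degree h"
  proof -
    have "degree f = card Fb" unfolding Fb_def using cf[OF x] by simp
    also have "\<dots> = (\<Sum>w\<in>poly g ` Fb. card {y \<in> Fb. poly g y = w})"
      using sum.image_gen[OF finFb, of "\<lambda>_. 1::nat" "poly g"] by simp
    also have "\<dots> = (\<Sum>w\<in>poly g ` Fb. degree h)"
    proof (rule sum.cong[OF refl])
      fix w assume "w \<in> poly g ` Fb"
      then obtain y where y: "y \<in> Fb" "w = poly g y" by blast
      then have "y \<notin> Z" using fib[OF x] unfolding Fb_def by blast
      moreover have "{z \<in> Fb. poly g z = w} = {z. poly f z = poly f y \<and> poly g z = poly g y}"
        using y unfolding Fb_def by auto
      ultimately show "card {y \<in> Fb. poly g y = w} = degree h" using ch by simp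
    qed
    finally show ?thesis by simp
  qed
  ultimately have "degree C * gcd (degree f) (degree g) \<le> degree C * degree h"
    unfolding dC by simp
  then have "gcd (degree f) (degree g) \<le> degree h" using Cpos by simp
  moreover have "degree h dvd gcd (degree f) (degree g)"
    using huv by (metis degree_pcompose dvd_triv_right gcd_greatest)
  ultimately have "degree h = gcd (degree f) (degree g)"
    using p(1) by (metis dvd_imp_le gcd_pos_nat le_antisym less_irrefl)
  then show ?thesis using huv by blast
qed

section \<open>Polynomials linearly equivalent to a power\<close>

text \<open>\<open>z^p\<close> composed with linear polynomials on both sides; the scaling of the
  inner one is absorbed into \<open>a\<close>.\<close>

definition power_equivalent :: "nat \<Rightarrow> complex poly \<Rightarrow> bool" where
  "power_equivalent p P \<longleftrightarrow> (\<exists>a b c. a \<noteq> 0 \<and> P = smult a ([:-b, 1:] ^ p) + [:c:])"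

lemma degree_power_equivalent:
  assumes "power_equivalent p P" shows "degree P = p"
proof -
  obtain a b c where a: "a \<noteq> 0" and P: "P = smult a ([:-b, 1:] ^ p) + [:c:]"
    using assms unfolding power_equivalent_def by blast
  have d: "degree (smult a ([:-b, 1:] ^ p)) = p" using a by (simp add: degree_linear_power)
  then show ?thesis unfolding P
    by (cases "p = 0") (auto simp: degree_add_eq_left)
qed

lemma linear_poly_cases:
  fixes L :: "complex poly"
  assumes "degree L = 1" obtains a b where "a \<noteq> 0" "L = [:b, a:]"
  using assms by (metis degree_eq_zeroE degree_pCons_eq_if pCons_cases one_neq_zero pCons_0_0 degree_pCons_0 diff_Suc_1 One_nat_def Suc_inject)

lemma power_equivalent_left:
  assumes "degree L = 1" "power_equivalent p P"
  shows "power_equivalent p (pcompose L P)"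
proof -
  obtain s t where L: "s \<noteq> 0" "L = [:t, s:]" using linear_poly_cases[OF assms(1)] .
  obtain a b c where "a \<noteq> 0" and P: "P = smult a ([:-b, 1:] ^ p) + [:c:]"
    using assms unfolding power_equivalent_def by blast
  then have "pcompose L P = smult (s * a) ([:-b, 1:] ^ p) + [:t + s * c:]" "s * a \<noteq> 0"
    using L by (simp_all add: pcompose_pCons smult_add_right)
  then show ?thesis unfolding power_equivalent_def by blast
qed

lemma power_equivalent_right:
  assumes "degree L = 1" "power_equivalent p P"
  shows "power_equivalent p (pcompose P L)"
proof -
  obtain s t where L: "s \<noteq> 0" "L = [:t, s:]" using linear_poly_cases[OF assms(1)] .
  obtain a b c where a: "a \<noteq> 0" and P: "P = smult a ([:-b, 1:] ^ p) + [:c:]"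
    using assms unfolding power_equivalent_def by blast
  have "pcompose [:-b, 1:] L = smult s [:-((b - t) / s), 1:]" using L by (simp add: pcompose_pCons)
  then have "pcompose P L = smult (a * s ^ p) ([:-((b - t) / s), 1:] ^ p) + [:c:]"
    unfolding P by (simp only: pcompose_add pcompose_smult pcompose_power pcompose_const smult_power smult_smult)
  moreover have "a * s ^ p \<noteq> 0" using a L by simp
  ultimately show ?thesis unfolding power_equivalent_def by blast
qed

lemma linear_inverse:
  fixes L :: "complex poly"
  assumes "degree L = 1"
  obtains M where "degree M = 1" "pcompose L M = [:0,1:]" "pcompose M L = [:0,1:]"
proof -
  obtain a b where L: "a \<noteq> 0" "L = [:b, a:]" using linear_poly_cases[OF assms] .
  show ?thesis by (rule that[of "[:-b/a, 1/a:]"]) (use L in \<open>auto simp: pcompose_pCons\<close>)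
qed

lemma power_equivalent_left_iff:
  assumes "degree L = 1"
  shows "power_equivalent p (pcompose L P) \<longleftrightarrow> power_equivalent p P"
proof -
  obtain M where M: "degree M = 1" "pcompose M L = [:0,1:]" using linear_inverse[OF assms] .
  have "pcompose M (pcompose L P) = P" using M by (simp add: pcompose_assoc pcompose_pCons)
  then show ?thesis using power_equivalent_left assms M by metis
qed

lemma power_equivalent_right_iff:
  assumes "degree L = 1"
  shows "power_equivalent p (pcompose P L) \<longleftrightarrow> power_equivalent p P"
proof -
  obtain M where M: "degree M = 1" "pcompose L M = [:0,1:]" using linear_inverse[OF assms] .
  have "pcompose (pcompose P L) M = P" using M by (simp add: pcompose_assoc[symmetric])
  then show ?thesis using power_equivalent_right assms M by metis
qed

lemma order_power_eq:
  fixes P :: "complex poly"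
  assumes "P \<noteq> 0" shows "order z (P ^ n) = n * order z P"
  using assms by (induction n) (simp_all add: order_mult)

text \<open>Some root \<open>r\<close> of \<open>C - c\<close> has multiplicity prime to \<open>p\<close>; then every root of \<open>D - r\<close> has
  multiplicity divisible by \<open>p = deg D\<close>.\<close>

lemma power_equivalent_transfer_left:
  assumes eq: "pcompose A B = pcompose C D" and p: "prime p" and dD: "degree D = p"
    and dC: "\<not> p dvd degree C" and A: "power_equivalent p A"
  shows "power_equivalent p D"
proof -
  obtain a b c where a: "a \<noteq> 0" and Aeq: "A = smult a ([:-b, 1:] ^ p) + [:c:]"
    using A unfolding power_equivalent_def by blast
  have ppos: "p > 0" using p prime_gt_0_nat by blast
  have dCpos: "degree C > 0" using dC by (metis dvd_0_right gr0I)
  define C' where "C' = C - [:c:]"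
  define B' where "B' = pcompose [:-b, 1:] B"
  have dC': "degree C' = degree C" unfolding C'_def using degree_diff_const(1)[OF dCpos] .
  have eq': "smult a (B' ^ p) = pcompose C' D"
    using eq unfolding Aeq B'_def C'_def
    by (simp add: pcompose_add pcompose_diff pcompose_smult pcompose_power algebra_simps)
  have C'n: "C' \<noteq> 0" using dC' dCpos by auto
  \<comment> \<open>The multiplicities of the roots add up to \<open>degree C\<close>, which
    \<open>p\<close> does not divide.\<close>
  have "\<exists>r. poly C' r = 0 \<and> \<not> p dvd order r C'"
  proof (rule ccontr)
    assume "\<not> ?thesis"
    then have "p dvd order r C'" if "poly C' r = 0" for r using that by blast
    then have "p dvd size (proots C')"
      unfolding size_multiset_overloaded_eq
      by (intro dvd_sum) (auto simp: C'n)
    then show False using dC dC' size_proots_complex by metis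
  qed
  then obtain r where r: "poly C' r = 0" "\<not> p dvd order r C'" by blast
  define m where "m = order r C'"
  obtain K where K: "C' = [:-r, 1:] ^ m * K" "\<not> [:-r, 1:] dvd K"
    using order_decomp[OF C'n] unfolding m_def by blast
  have Kr: "poly K r \<noteq> 0" using K(2) by (simp add: poly_eq_0_iff_dvd)
  define D' where "D' = D - [:r:]"
  have dD': "degree D' = p" unfolding D'_def using dD ppos degree_diff_const(1) by simp
  then have "\<not> constant (poly D')" using ppos constant_degree by (metis less_irrefl)
  then obtain z where z: "poly D' z = 0" using fundamental_theorem_of_algebra by blast
  have eq2: "smult a (B' ^ p) = D' ^ m * pcompose K D"
  proof -
    have "pcompose [:-r, 1:] D = D'" unfolding D'_def by (simp add: pcompose_pCons)
    then show ?thesis unfolding eq' K(1) by (simp add: pcompose_mult pcompose_power)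
  qed
  \<comment> \<open>Only the factor \<open>D' ^ m\<close> contributes to the order at
    \<open>z\<close>, which makes \<open>m * order z D'\<close> a multiple of
    \<open>p\<close>.\<close>
  have "poly (pcompose K D) z \<noteq> 0" using z Kr unfolding D'_def by (simp add: poly_pcompose)
  then have oK: "order z (pcompose K D) = 0" "pcompose K D \<noteq> 0" by (auto simp: order_0I)
  have D'n: "D' \<noteq> 0" using dD' ppos by auto
  have "order z (smult a (B' ^ p)) = m * order z D'"
    unfolding eq2 using oK D'n by (simp add: order_mult order_power_eq)
  moreover have "B' \<noteq> 0" using eq2 oK(2) D'n ppos by (auto simp: power_0_left)
  ultimately have "p * order z B' = m * order z D'" using a by (simp add: order_smult order_power_eq)
  then have "p dvd order z D'" using r(2) p unfolding m_def[symmetric]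
    by (metis dvd_triv_left prime_dvd_mult_iff)
  moreover have "order z D' > 0" using z D'n by (simp add: order_root)
  ultimately have "order z D' \<ge> p" by (simp add: dvd_imp_le)
  \<comment> \<open>As \<open>degree D' = p\<close>, the single root \<open>z\<close> exhausts
    \<open>D'\<close>.\<close>
  then have "[:-z, 1:] ^ p dvd D'" using order_1[of z D'] le_imp_power_dvd dvd_trans by blast
  then obtain q where q: "D' = [:-z, 1:] ^ p * q" by blast
  then have "degree q = 0" using D'n dD'
    by (metis add_cancel_right_right degree_linear_power degree_mult_eq mult_eq_0_iff)
  then obtain s where s: "q = [:s:]" by (metis degree_eq_zeroE)
  then have "D = smult s ([:-z, 1:] ^ p) + [:r:]" "s \<noteq> 0"
    using q D'n unfolding D'_def by (auto simp: algebra_simps)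
  then show ?thesis unfolding power_equivalent_def by blast
qed

lemma root_of_unity_eq_1:
  fixes z :: complex
  assumes "z ^ p = 1" "z ^ k = 1" "coprime k p" "k > 0"
  shows "z = 1"
proof -
  obtain x y where "k * x = p * y + 1" using bezout_nat[of k p] assms by auto
  then have "z ^ (k * x) = z ^ (p * y) * z" by (simp add: power_add)
  then show ?thesis using assms by (simp add: power_mult)
qed

text \<open>If \<open>D\<close> is invariant under the rotation \<open>M\<close>, comparing the expansions of \<open>A \<circ> B\<close> and
  \<open>A \<circ> B \<circ> M\<close> at infinity shows that, up to a translation, \<open>B \<circ> M\<close> is a root of unity times
  \<open>B\<close>, so \<open>A\<close> is a polynomial in the \<open>p\<close>-th power.\<close>

lemma power_equivalent_transfer_right:
  assumes eq: "pcompose A B = pcompose C D" and p: "prime p" and dA: "degree A = p"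
    and dB: "\<not> p dvd degree B" and D: "power_equivalent p D"
  shows "power_equivalent p A"
proof -
  obtain a b c where a: "a \<noteq> 0" and Deq: "D = smult a ([:-b, 1:] ^ p) + [:c:]"
    using D unfolding power_equivalent_def by blast
  have p2: "p \<ge> 2" using p prime_ge_2_nat by blast
  have Bpos: "degree B > 0" using dB by (metis dvd_0_right gr0I)
  have "card {z::complex. z ^ p = 1} = p" using card_nth_roots[of 1 p] p2 by simp
  then have "{z::complex. z ^ p = 1} \<noteq> {1}" using p2 by force
  then obtain \<zeta> :: complex where zeta: "\<zeta> ^ p = 1" "\<zeta> \<noteq> 1" by (auto simp: set_eq_iff)
  have "\<zeta> \<noteq> 0" using zeta p2 by (auto simp: power_0_left)
  \<comment> \<open>The factor by which the rotation \<open>M\<close> multiplies the leading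
    coefficient of \<open>B\<close>. Since \<open>p\<close> does not divide \<open>degree B\<close>,
    a power of \<omega> is 1 only for exponents divisible by \<open>p\<close>.\<close>
  define \<omega> where "\<omega> = \<zeta> ^ degree B"
  have om: "\<omega> ^ p = 1" "\<omega> \<noteq> 0" unfolding \<omega>_def using zeta \<open>\<zeta> \<noteq> 0\<close>
    by (auto simp: power_mult[symmetric] mult.commute[of "degree B"]) (simp add: power_mult)
  have omk: "\<omega> ^ k \<noteq> 1" if "\<not> p dvd k" for k
  proof
    assume "\<omega> ^ k = 1"
    then have "\<zeta> ^ (degree B * k) = 1" unfolding \<omega>_def by (simp add: power_mult)
    moreover have "\<not> p dvd degree B * k" using dB that p prime_dvd_mult_iff by blast
    then have "coprime (degree B * k) p" using p prime_imp_coprime coprime_commute by blast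
    moreover have "degree B * k > 0" using \<open>\<not> p dvd degree B * k\<close> by (metis dvd_0_right gr0I)
    ultimately show False using root_of_unity_eq_1[OF zeta(1)] zeta(2) by blast
  qed
  \<comment> \<open>The rotation by \<zeta> about the centre \<open>b\<close> of
    \<open>D\<close>.\<close>
  define M where "M = [:b - \<zeta> * b, \<zeta>:]"
  have "degree M = 1" unfolding M_def using \<open>\<zeta> \<noteq> 0\<close> by simp
  have "pcompose [:-b, 1:] M = smult \<zeta> [:-b, 1:]" unfolding M_def by (simp add: pcompose_pCons)
  then have "pcompose D M = D" unfolding Deq
    by (simp only: pcompose_add pcompose_smult pcompose_power pcompose_const smult_power zeta) simp
  then have inv: "pcompose A (pcompose B M) = pcompose A B"
    using eq by (metis pcompose_assoc)
  have "A \<noteq> 0" using dA p2 by auto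
  obtain l where l: "l ^ p = lead_coeff A" using complex_root_exists[of p] p2 by auto
  have "degree A = p * 1" "p \<ge> 1" using dA p2 by auto
  \<comment> \<open>A linear approximate \<open>p\<close>-th root of \<open>A\<close>, whose
    remainder \<open>R\<close> has no terms in degrees from \<open>p - 1\<close> on.\<close>
  from approximate_root[OF this(1,2) order_refl l \<open>A \<noteq> 0\<close>]
  obtain H where H: "degree H = 1" "\<And>i. i \<ge> p - 1 \<Longrightarrow> coeff (A - H ^ p) i = 0" by auto
  define R where "R = A - H ^ p"
  have A: "A = H ^ p + R" unfolding R_def by simp
  define X Y where "X = pcompose H B" and "Y = pcompose H (pcompose B M)"
  have dX: "degree X = degree B" "degree Y = degree B"
    unfolding X_def Y_def using H \<open>degree M = 1\<close> by (simp_all add: degree_pcompose)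
  have "lead_coeff M = \<zeta>" unfolding M_def using \<open>\<zeta> \<noteq> 0\<close> by simp
  then have "lead_coeff (pcompose B M) = \<omega> * lead_coeff B"
    using lead_coeff_comp[of M B] \<open>degree M = 1\<close> unfolding \<omega>_def by simp
  moreover have "degree (pcompose B M) > 0" using Bpos \<open>degree M = 1\<close> by (simp add: degree_pcompose)
  ultimately have lY: "lead_coeff Y = \<omega> * lead_coeff X"
    unfolding X_def Y_def using lead_coeff_comp[of _ H] H Bpos by simp
  \<comment> \<open>Rescaled to the leading coefficient of \<open>X\<close>; the \<open>p\<close>-th
    power does not change because \<open>\<omega> ^ p = 1\<close>.\<close>
  define Y' where "Y' = smult (1 / \<omega>) Y"
  have Y'p: "Y' ^ p = Y ^ p" unfolding Y'_def using om by (simp add: smult_power power_divide)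
  have "X = Y'"
  proof (rule eq_if_degree_power_diff_small[where n = "degree B" and m = p])
    show "coeff (X ^ p - Y' ^ p) i = 0" if i: "i \<ge> degree B * (p - 1)" for i
    proof -
      have i': "i \<ge> (p - 1) * degree B" using i by (simp only: mult.commute)
      have "X ^ p + pcompose R B = Y ^ p + pcompose R (pcompose B M)"
        using inv unfolding A X_def Y_def by (simp add: pcompose_add pcompose_power)
      then have "X ^ p - Y' ^ p = pcompose R (pcompose B M) - pcompose R B"
        unfolding Y'p by (simp add: algebra_simps)
      moreover have "coeff (pcompose R B) i = 0"
        by (rule coeff_pcompose_eq_0[OF H(2)[folded R_def] Bpos]) (use i' in auto)
      moreover have "coeff (pcompose R (pcompose B M)) i = 0"
        by (rule coeff_pcompose_eq_0[OF H(2)[folded R_def]])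
          (use i' Bpos \<open>degree M = 1\<close> in \<open>auto simp: degree_pcompose\<close>)
      ultimately show ?thesis by simp
    qed
    show "X \<noteq> 0" using dX Bpos by auto
  qed (use dX lY om p2 in \<open>auto simp: Y'_def\<close>)
  then have Y: "Y = smult \<omega> X" unfolding Y'_def using om by simp
  obtain N where N: "degree N = 1" "pcompose H N = [:0,1:]" "pcompose N H = [:0,1:]"
    using linear_inverse[OF H(1)] .
  \<comment> \<open>In the coordinate given by \<open>H\<close> the invariance reads
    \<open>A'(\<omega> z) = A'(z)\<close>. Only exponents divisible by \<open>p\<close> survive, and
    in degree \<open>p\<close> these are 0 and \<open>p\<close>.\<close>
  define A' where "A' = pcompose A N"
  have NH: "pcompose N (pcompose H Q) = Q" for Q using N by (simp add: pcompose_assoc pcompose_pCons)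
  have "pcompose (pcompose A' [:0, \<omega>:]) X = pcompose A' Y"
    unfolding Y by (simp add: pcompose_assoc[symmetric] pcompose_pCons)
  also have "\<dots> = pcompose A' X"
    unfolding A'_def Y_def X_def using inv by (simp add: pcompose_assoc[symmetric] NH)
  finally have "pcompose A' [:0, \<omega>:] = A'"
    using pcompose_right_cancel dX Bpos by metis
  then have omc: "\<omega> ^ k * coeff A' k = coeff A' k" for k
    using coeff_pcompose_monom_linear[of A' \<omega> k] by (simp add: monom_Suc monom_0)
  then have Ak: "coeff A' k = 0" if "\<not> p dvd k" for k 
  proof -
    have "(\<omega> ^ k - 1) * coeff A' k = 0" using omc[of k] by (simp add: algebra_simps)
    then show ?thesis using omk[OF that] by simp
  qed
  have dA': "degree A' = p" unfolding A'_def using N dA by (simp add: degree_pcompose)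
  have "A' = smult (lead_coeff A') ([:-0, 1:] ^ p) + [:coeff A' 0:]"
  proof (rule poly_eqI)
    fix k
    have e: "smult (lead_coeff A') ([:-0, 1:] ^ p) = monom (lead_coeff A') p" by (simp add: monom_altdef)
    show "coeff A' k = coeff (smult (lead_coeff A') ([:-0, 1:] ^ p) + [:coeff A' 0:]) k"
    proof (cases "p dvd k")
      case False
      then have "k \<noteq> 0" "k \<noteq> p" by (metis dvd_0_right dvd_refl)+
      then show ?thesis unfolding e using Ak[OF False] by (simp add: coeff_pCons split: nat.splits)
    next
      case True
      consider "k = 0" | "k = p" | "k > p" using True p2
        by (metis dvd_imp_le linorder_neqE_nat not_le gr0I)
      then show ?thesis unfolding e using dA' p2
        by cases (auto simp: coeff_pCons coeff_eq_0 split: nat.splits)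
    qed
  qed
  moreover have "lead_coeff A' \<noteq> 0" using dA' p2 by auto
  ultimately have "power_equivalent p A'" unfolding power_equivalent_def by blast
  moreover have "A = pcompose A' H" unfolding A'_def using N by (simp add: pcompose_assoc[symmetric])
  ultimately show ?thesis using power_equivalent_right[OF H(1)] by metis
qed

section \<open>Prime decompositions\<close>

lemma comp_prime_linear: "degree L = 1 \<Longrightarrow> comp_prime L"
  unfolding comp_prime_def by (auto simp: degree_pcompose)

lemma comp_prime_of_prime_degree:
  assumes "prime (degree P)" shows "comp_prime P"
  unfolding comp_prime_def
proof (intro conjI allI impI)
  show "degree P > 0" using assms prime_gt_0_nat by blast
  fix Q R assume "P = pcompose Q R"
  then have "prime (degree Q * degree R)" using assms by (simp add: degree_pcompose)
  then show "degree Q = 1 \<or> degree R = 1" by (rule prime_product)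
qed

lemma comp_prime_pcompose_linear:
  assumes "comp_prime P" "degree L = 1" shows "comp_prime (pcompose P L)"
  unfolding comp_prime_def
proof (intro conjI allI impI)
  show "degree (pcompose P L) > 0" using assms unfolding comp_prime_def by (simp add: degree_pcompose)
  fix Q R assume eq: "pcompose P L = pcompose Q R"
  obtain M where M: "degree M = 1" "pcompose L M = [:0,1:]" using linear_inverse[OF assms(2)] .
  have "P = pcompose (pcompose P L) M" using M by (simp add: pcompose_assoc[symmetric])
  then have "P = pcompose Q (pcompose R M)" unfolding eq by (simp add: pcompose_assoc)
  then have "degree Q = 1 \<or> degree (pcompose R M) = 1" using assms unfolding comp_prime_def by blast
  then show "degree Q = 1 \<or> degree R = 1" using M by (simp add: degree_pcompose)
qed

lemma foldr_pcompose_append: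
  fixes Ps Qs :: "complex poly list"
  shows "foldr pcompose (Ps @ Qs) [:0, 1:] = pcompose (foldr pcompose Ps [:0, 1:]) (foldr pcompose Qs [:0, 1:])"
  by (induction Ps) (simp_all add: pcompose_assoc pcompose_pCons)

lemma prime_decomposition_append:
  assumes "prime_decomposition P Ps" "prime_decomposition Q Qs"
  shows "prime_decomposition (pcompose P Q) (Ps @ Qs)"
  using assms unfolding prime_decomposition_def foldr_pcompose_append by auto

lemma prime_decomposition_single: "comp_prime P \<Longrightarrow> prime_decomposition P [P]"
  unfolding prime_decomposition_def by simp

lemma prime_decomposition_degree_pos:
  assumes "prime_decomposition P Ps" shows "degree P > 0"
proof -
  have "\<forall>Q\<in>set Ps. comp_prime Q \<Longrightarrow> degree (foldr pcompose Ps [:0,1:]) > 0"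
    by (induction Ps) (auto simp: degree_pcompose comp_prime_def)
  then show ?thesis using assms unfolding prime_decomposition_def by blast
qed

lemma prime_decomposition_exists:
  assumes "degree P > 0" shows "\<exists>Ps. prime_decomposition P Ps"
  using assms
proof (induction "degree P" arbitrary: P rule: less_induct)
  case less
  show ?case
  proof (cases "comp_prime P")
    case True then show ?thesis using prime_decomposition_single by blast
  next
    case False
    then obtain Q R where P: "P = pcompose Q R" and d: "degree Q \<noteq> 1" "degree R \<noteq> 1"
      using less.prems unfolding comp_prime_def by blast
    have dp: "degree P = degree Q * degree R" unfolding P by (simp add: degree_pcompose)
    then have "degree Q > 1" "degree R > 1" using d less.prems
      by (metis less_one linorder_neqE_nat mult_is_0 less_irrefl)+
    then have "degree Q < degree P" "degree R < degree P" unfolding dp by simp_all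
    then obtain Qs Rs where "prime_decomposition Q Qs" "prime_decomposition R Rs"
      using less.hyps \<open>degree Q > 1\<close> \<open>degree R > 1\<close> by (metis less_trans zero_less_one)
    then show ?thesis using prime_decomposition_append unfolding P by blast
  qed
qed

section \<open>Weights of decompositions, with linear equivalence in place of the Hurwitz
  class\<close>

definition prime_weight :: "nat \<Rightarrow> complex poly \<Rightarrow> complex" where
  "prime_weight p P = (if power_equivalent p P then of_nat p else 1)"

definition weight_value :: "nat \<Rightarrow> complex poly \<Rightarrow> complex \<Rightarrow> bool" where
  "weight_value p P v \<longleftrightarrow> (\<exists>Ps. prime_decomposition P Ps \<and> v = prod_list (map (prime_weight p) Ps))"

lemma weight_value_pcompose:
  "weight_value p P v \<Longrightarrow> weight_value p Q w \<Longrightarrow> weight_value p (pcompose P Q) (v * w)"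
  unfolding weight_value_def using prime_decomposition_append by fastforce

lemma weight_value_prime: "comp_prime P \<Longrightarrow> weight_value p P (prime_weight p P)"
  unfolding weight_value_def by (intro exI[of _ "[P]"]) (simp add: prime_decomposition_single)

lemma prime_weight_linear: "degree L = 1 \<Longrightarrow> p \<noteq> 1 \<Longrightarrow> prime_weight p L = 1"
  unfolding prime_weight_def using degree_power_equivalent by force

lemma weight_value_linear: "degree L = 1 \<Longrightarrow> p \<noteq> 1 \<Longrightarrow> weight_value p L 1"
  using weight_value_prime comp_prime_linear prime_weight_linear by metis

lemma prod_weight_linear:
  assumes "prime_decomposition P Ps" "degree P = 1" "p \<noteq> 1"
  shows "prod_list (map (prime_weight p) Ps) = 1"
proof -
  have "\<forall>Q\<in>set Ps. comp_prime Q \<Longrightarrow> degree (foldr pcompose Ps [:0,1:]) = 1 \<Longrightarrow>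
    prod_list (map (prime_weight p) Ps) = 1"
    by (induction Ps) (auto simp: degree_pcompose prime_weight_linear[OF _ assms(3)])
  then show ?thesis using assms unfolding prime_decomposition_def by blast
qed

text \<open>\<open>B\<close> is the last nonlinear factor, with the linear factors to its right absorbed.\<close>

lemma weight_value_split:
  assumes p: "p \<noteq> 1"
  shows "\<forall>Q\<in>set Ps. comp_prime Q \<Longrightarrow> degree (foldr pcompose Ps [:0,1:]) > 1 \<Longrightarrow>
    \<exists>F B v. foldr pcompose Ps [:0,1:] = pcompose F B \<and> comp_prime B \<and> degree B > 1 \<and>
      weight_value p F v \<and> prod_list (map (prime_weight p) Ps) = v * prime_weight p B"
proof (induction Ps rule: rev_induct)
  case Nil then show ?case by simp
next
  case (snoc L Ps)
  define F where "F = foldr pcompose Ps [:0,1:]"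
  have P: "foldr pcompose (Ps @ [L]) [:0,1:] = pcompose F L"
    unfolding foldr_pcompose_append F_def by simp
  have L: "comp_prime L" "degree L > 0" using snoc.prems unfolding comp_prime_def by auto
  show ?case
  proof (cases "degree L = 1")
    case False
    have "\<exists>v. weight_value p F v \<and> prod_list (map (prime_weight p) Ps) = v"
    proof (cases "Ps = []")
      \<comment> \<open>The empty list is not a decomposition, but its composition is the identity,
        which has weight 1 as a linear prime.\<close>
      case True
      then show ?thesis unfolding F_def using weight_value_linear[OF _ p, of "[:0,1:]"] by simp
    next
      case False
      then show ?thesis unfolding F_def weight_value_def prime_decomposition_def
        using snoc.prems by auto
    qed
    then show ?thesis unfolding P using L False by (intro exI[of _ F] exI[of _ L]) auto
  next
    case True
    then have "degree F > 1" using snoc.prems(2) unfolding P by (simp add: degree_pcompose)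
    then obtain F' B v where *: "F = pcompose F' B" "comp_prime B" "degree B > 1"
      "weight_value p F' v" "prod_list (map (prime_weight p) Ps) = v * prime_weight p B"
      using snoc unfolding F_def by auto
    have "pcompose F L = pcompose F' (pcompose B L)" unfolding * by (simp add: pcompose_assoc)
    moreover have "comp_prime (pcompose B L)" by (rule comp_prime_pcompose_linear[OF *(2) True])
    moreover have "degree (pcompose B L) > 1" using * True by (simp add: degree_pcompose)
    moreover have "prime_weight p (pcompose B L) = prime_weight p B"
      unfolding prime_weight_def using power_equivalent_right_iff[OF True] by simp
    moreover have "prime_weight p L = 1" by (rule prime_weight_linear[OF True p])
    ultimately show ?thesis unfolding P using * by (metis (no_types, lifting) list.map map_append
        mult.right_neutral prod_list.Nil prod_list.Cons prod_list.append)
  qed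
qed

text \<open>The left companion of a prime right factor: a decomposition \<open>A = A\<^sub>1 \<circ> A\<^sub>2\<close> would give \<open>D\<close> and
  \<open>A\<^sub>2 \<circ> B\<close> a common right factor of degree \<open>deg A\<^sub>2\<close>.\<close>

lemma comp_prime_transfer:
  assumes eq: "pcompose A B = pcompose C D" and co: "coprime (degree B) (degree D)"
    and d: "degree A = degree D" and D: "comp_prime D" and B: "degree B > 0"
  shows "comp_prime A"
  unfolding comp_prime_def
proof (intro conjI allI impI)
  show Apos: "degree A > 0" using D d unfolding comp_prime_def by simp
  fix A1 A2 assume A: "A = pcompose A1 A2"
  have dA: "degree A = degree A1 * degree A2" unfolding A by (simp add: degree_pcompose)
  have "pcompose A1 (pcompose A2 B) = pcompose C D" using eq unfolding A by (simp add: pcompose_assoc)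
  moreover have "degree (pcompose A1 (pcompose A2 B)) > 0"
    using Apos B dA by (simp add: degree_pcompose)
  ultimately obtain h u v where h: "D = pcompose v h"
     "degree h = gcd (degree (pcompose A2 B)) (degree D)"
    using common_right_factor_gcd by blast
  have "gcd (degree A2 * degree B) (degree D) = gcd (degree A2) (degree D)"
    using co gcd_mult_left_right_cancel[of "degree D" "degree B" "degree A2"]
    by (simp add: coprime_commute)
  also have "\<dots> = degree A2" using dA d by (metis dvd_triv_right gcd_nat.absorb1)
  finally have "degree h = degree A2" using h(2) by (simp only: degree_pcompose)
  moreover have "degree v = degree A1"
  proof -
    have "degree v * degree A2 = degree A1 * degree A2" using h dA d calculation by (metis degree_pcompose)
    then show ?thesis using Apos dA by auto
  qed
  moreover have "degree v = 1 \<or> degree h = 1" using D h unfolding comp_prime_def by blast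
  ultimately show "degree A1 = 1 \<or> degree A2 = 1" by simp
qed

text \<open>Both weights are 1 unless the common degree is \<open>p\<close>. In that case
  coprimality keeps \<open>p\<close> from dividing \<open>degree B = degree C\<close>, as both
  transfer lemmas require.\<close>

lemma prime_weight_transfer:
  assumes eq: "pcompose A B = pcompose C D" and co: "coprime (degree B) (degree D)"
    and d: "degree A = degree D" "degree B = degree C" and p: "prime p"
  shows "prime_weight p A = prime_weight p D"
proof (cases "degree D = p")
  case False
  then show ?thesis unfolding prime_weight_def using d degree_power_equivalent by metis
next
  case True
  then have nd: "\<not> p dvd degree B" using co p
    by (metis coprime_absorb_right not_prime_unit)
  have "power_equivalent p A \<longleftrightarrow> power_equivalent p D"
    using power_equivalent_transfer_left[OF eq p True] power_equivalent_transfer_right[OF eq p]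
      nd d True by auto
  then show ?thesis unfolding prime_weight_def by simp
qed

lemma weight_value_unique:
  assumes p: "prime p"
  shows "weight_value p P v \<Longrightarrow> weight_value p P w \<Longrightarrow> v = w"
proof (induction "degree P" arbitrary: P v w rule: less_induct)
  case less
  have p1: "p \<noteq> 1" using p not_prime_1 by blast
  obtain Ps Qs where Ps: "prime_decomposition P Ps" "v = prod_list (map (prime_weight p) Ps)"
    and Qs: "prime_decomposition P Qs" "w = prod_list (map (prime_weight p) Qs)"
    using less.prems unfolding weight_value_def by blast
  have Ppos: "degree P > 0" using prime_decomposition_degree_pos Ps by blast
  show ?case
  proof (cases "degree P = 1")
    case True
    then show ?thesis using Ps Qs prod_weight_linear p1 by metis
  next
    case False
    then have P1: "degree P > 1" using Ppos by simp
    from weight_value_split[OF p1, of Ps] obtain F B vF where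
      FB: "P = pcompose F B" "comp_prime B" "degree B > 1" "weight_value p F vF" "v = vF * prime_weight p B"
      using Ps P1 unfolding prime_decomposition_def by metis
    from weight_value_split[OF p1, of Qs] obtain G D vG where
      GD: "P = pcompose G D" "comp_prime D" "degree D > 1" "weight_value p G vG" "w = vG * prime_weight p D"
      using Qs P1 unfolding prime_decomposition_def by metis
    have dP: "degree P = degree F * degree B" "degree P = degree G * degree D"
      using FB GD by (metis degree_pcompose)+
    then have Fpos: "degree F > 0" "degree G > 0" using Ppos by (metis gr0I less_irrefl mult_0)+
    have ltF: "degree F < degree P" using dP(1) FB(3) Fpos(1) by simp
    have ltG: "degree G < degree P" using dP(2) GD(3) Fpos(2) by simp
    have e: "pcompose F B = pcompose G D" "degree (pcompose F B) > 0" using FB GD Ppos by auto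
    show ?thesis
    proof (cases "coprime (degree B) (degree D)")
      case False
      obtain h b d where h: "B = pcompose b h" "D = pcompose d h" "degree h = gcd (degree B) (degree D)"
        using common_right_factor_gcd[OF e] by blast
      have "degree h \<noteq> 1" using False h by (simp add: coprime_iff_gcd_eq_1)
      \<comment> \<open>\<open>B\<close> and \<open>D\<close> are prime and \<open>h\<close> is not
        linear, so the left quotients are. Then \<open>B\<close> is \<open>D\<close> followed by a
        linear \<open>L\<close>, and \<open>F\<close> composed with \<open>L\<close> is
        \<open>G\<close>.\<close>
      then have lin: "degree b = 1" "degree d = 1" using FB(2) GD(2) h unfolding comp_prime_def by blast+
      obtain d' where d': "degree d' = 1" "pcompose d' d = [:0,1:]" using linear_inverse[OF lin(2)] .
      define L where "L = pcompose b d'"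
      have L1: "degree L = 1" unfolding L_def using lin d' by (simp add: degree_pcompose)
      have "pcompose d' D = h" unfolding h(2) using d' by (simp add: pcompose_assoc pcompose_pCons)
      then have BL: "B = pcompose L D" unfolding L_def using h(1) by (simp add: pcompose_assoc[symmetric])
      have "pcompose (pcompose F L) D = pcompose G D" using e(1) unfolding BL by (simp add: pcompose_assoc)
      then have "pcompose F L = G" using pcompose_right_cancel GD(3) by auto
      then have "weight_value p G (vF * 1)"
        using weight_value_pcompose[OF FB(4) weight_value_linear[OF L1 p1]] by simp
      then have "vF = vG" using less.hyps[OF ltG] GD(4) by simp
      moreover have "prime_weight p B = prime_weight p D"
        unfolding BL prime_weight_def using power_equivalent_left_iff[OF L1] by simp
      ultimately show ?thesis using FB GD by simp
    next
      case co: True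
      obtain A C where AC: "pcompose A B = pcompose C D" "degree (pcompose A B) = lcm (degree B) (degree D)"
        using common_left_multiple_lcm[OF e] by blast
      have dE: "degree (pcompose A B) = degree B * degree D" using AC(2) co lcm_coprime by fastforce
      have dA: "degree A = degree D" using dE FB(3) by (simp add: degree_pcompose)
      have dC: "degree B = degree C" using dE GD(3) AC(1) by (simp add: degree_pcompose)
      \<comment> \<open>\<open>F\<close> and \<open>G\<close> have smaller degree, so induction
        evaluates them through \<open>K\<close> followed by \<open>A\<close> and by
        \<open>C\<close>. The weights of \<open>A\<close> and \<open>C\<close> are those of
        \<open>D\<close> and \<open>B\<close>, so the products agree.\<close>
      obtain K where K: "P = pcompose K (pcompose A B)"
        using factor_through_lcm[OF refl AC(1) AC(2) _ _ FB(1) GD(1)] FB(3) GD(3) by auto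
      have F: "F = pcompose K A" 
        by (rule pcompose_right_cancel[of _ B]) (use K FB in \<open>auto simp: pcompose_assoc\<close>)
      have G: "G = pcompose K C" 
        by (rule pcompose_right_cancel[of _ D]) (use K GD AC(1) in \<open>auto simp: pcompose_assoc\<close>)
      have "degree K > 0" using Fpos unfolding F by (simp add: degree_pcompose)
      then obtain vK where vK: "weight_value p K vK"
        using prime_decomposition_exists unfolding weight_value_def by blast
      have Ap: "comp_prime A" using comp_prime_transfer[OF AC(1) co dA GD(2)] FB(3) by simp
      have Cp: "comp_prime C"
        using comp_prime_transfer[OF AC(1)[symmetric] _ dC[symmetric] FB(2)] co GD(3)
        by (simp add: coprime_commute)
      have "vF = vK * prime_weight p A"
        using less.hyps[OF ltF FB(4)] weight_value_pcompose[OF vK weight_value_prime[OF Ap]] F by simp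
      moreover have "vG = vK * prime_weight p C"
        using less.hyps[OF ltG GD(4)] weight_value_pcompose[OF vK weight_value_prime[OF Cp]] G by simp
      moreover have "prime_weight p A = prime_weight p D"
        by (rule prime_weight_transfer[OF AC(1) co dA dC p])
      moreover have "prime_weight p C = prime_weight p B"
        by (rule prime_weight_transfer[OF AC(1)[symmetric] _ dC[symmetric] dA[symmetric] p])
          (use co in \<open>simp add: coprime_commute\<close>)
      ultimately show ?thesis using FB(5) GD(5) by simp
    qed
  qed
qed

section \<open>The Hurwitz class of a power\<close>

lemma poly_map_id: "poly_map [:0, 1:] = id"
proof
  fix x show "poly_map [:0, 1:] x = id x" by (cases x) (simp_all add: poly_map_None)
qed

text \<open>Neighbourhoods of infinity are complements of compact sets, and the preimage of a
  compact set is its image under the inverse linear polynomial, hence compact.\<close>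

lemma poly_map_linear_continuous:
  assumes "degree L = 1"
  shows "continuous_map sphere_top sphere_top (poly_map L)"
  unfolding continuous_map_def
proof (intro conjI allI impI)
  show "poly_map L \<in> topspace sphere_top \<rightarrow> topspace sphere_top" by simp
  obtain M where M: "degree M = 1" "pcompose L M = [:0,1:]" "pcompose M L = [:0,1:]"
    using linear_inverse[OF assms] .
  have inv: "poly L (poly M z) = z" "poly M (poly L z) = z" for z
    using M arg_cong[of _ _ "\<lambda>p. poly p z"] by (simp_all flip: poly_pcompose)
  have None: "poly_map L None = None" using assms by (simp add: poly_map_None)
  fix U assume "openin sphere_top U"
  then consider V where "open V" "U = Some ` V"
    | C where "compact C" "U = insert None (Some ` (UNIV - C))"
    unfolding sphere_top_def openin_Alexandroff_compactification by auto
  then have "openin sphere_top {x. poly_map L x \<in> U}"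
  proof cases
    case 1
    have "{x. poly_map L x \<in> U} = Some ` (poly L -` V)"
    proof (intro set_eqI)
      fix x show "x \<in> {x. poly_map L x \<in> U} \<longleftrightarrow> x \<in> Some ` (poly L -` V)"
        using 1 None by (cases x) auto
    qed
    moreover have "open (poly L -` V)"
      using 1 by (intro open_vimage continuous_intros) auto
    ultimately show ?thesis unfolding sphere_top_def by simp
  next
    case 2
    have "poly L -` C = poly M ` C" using inv by (auto simp: image_iff) metis
    moreover have "compact (poly M ` C)"
      using 2 by (intro compact_continuous_image continuous_intros)
    ultimately have "compact (poly L -` C)" by simp
    moreover have "{x. poly_map L x \<in> U} = insert None (Some ` (UNIV - (poly L -` C)))"
    proof (intro set_eqI)
      fix x show "x \<in> {x. poly_map L x \<in> U} \<longleftrightarrow> x \<in> insert None (Some ` (UNIV - (poly L -` C)))"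
        using 2 None by (cases x) auto
    qed
    ultimately show ?thesis
      unfolding sphere_top_def openin_Alexandroff_compactification
      by (intro disjI2 exI[of _ "poly L -` C"]) (simp add: compact_imp_closed)
  qed
  then show "openin sphere_top {x \<in> topspace sphere_top. poly_map L x \<in> U}" by simp
qed

lemma poly_map_linear_homeomorphic:
  assumes "degree L = 1"
  shows "homeomorphic_map sphere_top sphere_top (poly_map L)"
proof -
  obtain M where M: "degree M = 1" "pcompose L M = [:0,1:]" "pcompose M L = [:0,1:]"
    using linear_inverse[OF assms] .
  have "poly_map L (poly_map M x) = x" "poly_map M (poly_map L x) = x" for x
    using M poly_map_pcompose[of L M] poly_map_pcompose[of M L] poly_map_id
    by (metis comp_apply id_apply)+
  then have "homeomorphic_maps sphere_top sphere_top (poly_map L) (poly_map M)"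
    unfolding homeomorphic_maps_def using poly_map_linear_continuous assms M by simp
  then show ?thesis by (rule homeomorphic_maps_imp_map)
qed

lemma hurwitz_class_power_if:
  assumes "power_equivalent p P"
  shows "poly_map P \<in> hurwitz_class (poly_map (monom 1 p))"
proof -
  obtain a b c where a: "a \<noteq> 0" and P: "P = smult a ([:-b, 1:] ^ p) + [:c:]"
    using assms unfolding power_equivalent_def by blast
  have lin: "degree [:b, 1:] = 1" "degree [:c, a:] = 1" using a by simp_all
  have "pcompose P [:b, 1:] = pcompose [:c, a:] (monom 1 p)"
    unfolding P by (simp add: pcompose_add pcompose_smult pcompose_power pcompose_pCons monom_altdef)
  then have "poly_map P \<circ> poly_map [:b, 1:] = poly_map [:c, a:] \<circ> poly_map (monom 1 p)"
    by (metis poly_map_pcompose)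
  then show ?thesis unfolding hurwitz_class_def
    using poly_map_in_Rat_maps poly_map_linear_homeomorphic lin by blast
qed

lemma power_equivalent_degree_if_single_root:
  assumes b: "{z. poly P z = c} = {b}" and P: "degree P > 0"
  shows "power_equivalent (degree P) P"
proof -
  define Q where "Q = P - [:c:]"
  have Q: "degree Q = degree P" "Q \<noteq> 0" unfolding Q_def using degree_diff_const[OF P] by simp_all
  have "{z. poly Q z = 0} = {b}" unfolding Q_def using b by simp
  then have Qeq: "Q = smult (lead_coeff Q) ([:-b, 1:] ^ order b Q)"
    using complex_poly_decompose[of Q] by simp
  have "degree (smult (lead_coeff Q) ([:-b, 1:] ^ order b Q)) = order b Q"
    using Q(2) by (simp add: degree_linear_power)
  then have "order b Q = degree P" using Qeq Q by metis
  then have "Q = smult (lead_coeff Q) ([:-b, 1:] ^ degree P)" using Qeq by simp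
  then have "P = smult (lead_coeff Q) ([:-b, 1:] ^ degree P) + [:c:]"
    unfolding Q_def by (metis diff_add_cancel)
  moreover have "lead_coeff Q \<noteq> 0" using Q(2) by (simp only: leading_coeff_0_iff not_False_eq_True)
  ultimately show ?thesis unfolding power_equivalent_def by blast
qed

text \<open>A homeomorphic equivalence preserves fibre cardinalities. The power map has exactly two fibres
  with one point, and a polynomial map always has one over \<open>\<infinity>\<close>, so it has another over a finite
  value.\<close>

lemma power_equivalent_if_hurwitz_class:
  assumes p: "p > 1" and H: "poly_map P \<in> hurwitz_class (poly_map (monom 1 p))"
  shows "power_equivalent p P"
proof -
  obtain \<phi> \<psi> where hom: "homeomorphic_map sphere_top sphere_top \<phi>" "homeomorphic_map sphere_top sphere_top \<psi>"
    and eq: "poly_map P \<circ> \<phi> = \<psi> \<circ> poly_map (monom 1 p)"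
    using H unfolding hurwitz_class_def by blast
  define m where "m = poly_map (monom (1::complex) p)"
  have phi: "inj \<phi>" "surj \<phi>" and psi: "inj \<psi>" "surj \<psi>"
    using hom homeomorphic_imp_injective_map homeomorphic_imp_surjective_map by fastforce+
  have mv: "m None = None" "m (Some z) = Some (z ^ p)" for z
    unfolding m_def using p by (simp_all add: poly_map_None degree_monom_eq poly_monom)
  have eqx: "poly_map P (\<phi> x) = \<psi> (m x)" for x
    using eq unfolding m_def by (metis comp_apply)
  have cards: "card {x. poly_map P x = \<psi> v} = card {y. m y = v}" for v
  proof -
    have "{x. poly_map P x = \<psi> v} = \<phi> ` {y. m y = v}"
    proof (intro set_eqI iffI)
      fix x assume x: "x \<in> {x. poly_map P x = \<psi> v}"
      obtain y where "x = \<phi> y" using phi(2) by (metis surjD)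
      then show "x \<in> \<phi> ` {y. m y = v}" using x eqx psi(1) by (simp add: inj_eq)
    qed (use eqx in auto)
    then show ?thesis using phi(1) by (simp add: card_image inj_on_subset)
  qed
  have "{y. m y = None} = {None}"
  proof (intro set_eqI)
    fix y show "y \<in> {y. m y = None} \<longleftrightarrow> y \<in> {None}" by (cases y) (simp_all add: mv)
  qed
  then have c1: "card {x. poly_map P x = \<psi> None} = 1" unfolding cards by simp
  have "{y. m y = Some w} = Some ` {z. z ^ p = w}" for w
  proof (intro set_eqI)
    fix y show "y \<in> {y. m y = Some w} \<longleftrightarrow> y \<in> Some ` {z. z ^ p = w}" by (cases y) (auto simp: mv)
  qed
  then have cw: "card {x. poly_map P x = \<psi> (Some w)} = card {z. z ^ p = w}" for w
    unfolding cards by (simp add: card_image)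
  have "{z::complex. z ^ p = 0} = {0}" using p by auto
  then have c2: "card {x. poly_map P x = \<psi> (Some 0)} = 1" unfolding cw by simp
  have ne: "\<psi> None \<noteq> \<psi> (Some 0)" using psi(1) by (metis injD option.distinct(1))
  have Ppos: "degree P > 0"
  proof (rule ccontr)
    assume "\<not> degree P > 0"
    then obtain c where "P = [:c:]" by (metis degree_eq_zeroE gr0I)
    then have con: "poly_map P x = Some c" for x by (cases x) (simp_all add: poly_map_None)
    have "{x. poly_map P x = \<psi> None} \<noteq> {}" "{x. poly_map P x = \<psi> (Some 0)} \<noteq> {}"
      using c1 c2 by (metis card.empty zero_neq_one)+
    then show False using con ne by (auto split: if_splits)
  qed
  have PNone: "poly_map P None = None" using Ppos by (simp add: poly_map_None)
  have fibS: "{x. poly_map P x = Some c} = Some ` {z. poly P z = c}" for c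
  proof (intro set_eqI)
    fix y show "y \<in> {x. poly_map P x = Some c} \<longleftrightarrow> y \<in> Some ` {z. poly P z = c}"
      using PNone by (cases y) auto
  qed
  obtain v0 c where v0: "\<psi> v0 = Some c" "card {x. poly_map P x = \<psi> v0} = 1"
    using ne c1 c2 by (metis not_None_eq)
  then have "card {z. poly P z = c} = 1" unfolding v0 fibS by (simp add: card_image)
  then obtain b where "{z. poly P z = c} = {b}" by (metis card_1_singletonE)
  then have pe: "power_equivalent (degree P) P"
    using power_equivalent_degree_if_single_root Ppos by blast
  then obtain a b c0 where a: "a \<noteq> 0" and Peq: "P = smult a ([:-b, 1:] ^ degree P) + [:c0:]"
    unfolding power_equivalent_def by blast
  \<comment> \<open>So far the exponent is only known to be \<open>degree P\<close>. Counting the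
    fibre over one more value, away from the exceptional values of both maps, identifies it with
    \<open>p\<close>.\<close>
  have "finite {v. \<psi> v \<in> {None, Some c0}}"
    using finite_vimageI[OF _ psi(1), of "{None, Some c0}"] by (simp add: vimage_def)
  moreover have "infinite (Some ` (- {0::complex}))"
    by (simp add: finite_image_iff infinite_UNIV_char_0 Compl_eq_Diff_UNIV)
  ultimately obtain w where w: "w \<noteq> 0" "\<psi> (Some w) \<notin> {None, Some c0}"
    by (metis (no_types, lifting) ComplD finite_subset image_subset_iff insertI1 mem_Collect_eq)
  then obtain c' where c': "\<psi> (Some w) = Some c'" "c' \<noteq> c0" by auto
  have "p = card {z. z ^ p = w}" using card_nth_roots[OF w(1)] p by simp
  also have "\<dots> = card {z. poly P z = c'}"
    unfolding cw[symmetric] c' fibS by (simp add: card_image)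
  also have "{z. poly P z = c'} = (\<lambda>t. t + b) ` {t. t ^ degree P = (c' - c0) / a}"
  proof (intro set_eqI)
    fix z
    have "poly P z = a * (z - b) ^ degree P + c0"
      by (subst Peq) (simp add: poly_power)
    then have "poly P z = c' \<longleftrightarrow> (z - b) ^ degree P = (c' - c0) / a"
      using a by (auto simp: field_simps)
    moreover have "z \<in> (\<lambda>t. t + b) ` S \<longleftrightarrow> z - b \<in> S" for S
      by (auto simp: image_iff algebra_simps intro: bexI[of _ "z - b"])
    ultimately show "z \<in> {z. poly P z = c'} \<longleftrightarrow> z \<in> (\<lambda>t. t + b) ` {t. t ^ degree P = (c' - c0) / a}"
      by simp
  qed
  also have "card \<dots> = card {t. t ^ degree P = (c' - c0) / a}"
    by (rule card_image) simp
  also have "\<dots> = degree P" using card_nth_roots[of "(c' - c0) / a" "degree P"] a c' Ppos by simp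
  finally show ?thesis using pe by simp
qed

lemma phi1_prime_eq_prime_weight: "p > 1 \<Longrightarrow> phi1_prime p P = prime_weight p P"
  unfolding phi1_prime_def prime_weight_def
  using hurwitz_class_power_if power_equivalent_if_hurwitz_class by auto

lemma phi1_value_eq_weight_value: 
  assumes "p > 1" shows "phi1_value p = weight_value p"
proof -
  have "phi1_prime p = prime_weight p" using phi1_prime_eq_prime_weight[OF assms] by blast
  then show ?thesis by (intro ext) (simp add: phi1_value_def weight_value_def)
qed

section \<open>Chebyshev polynomials\<close>

text \<open>The rescaled Chebyshev polynomials \<open>2 T_n(z/2)\<close>, which send
  \<open>z + 1/z\<close> to \<open>z^n + 1/z^n\<close>.\<close>

fun cheb :: "nat \<Rightarrow> complex poly" where
  "cheb 0 = [:2:]"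
| "cheb (Suc 0) = [:0, 1:]"
| "cheb (Suc (Suc n)) = [:0, 1:] * cheb (Suc n) - cheb n"

lemma poly_cheb:
  assumes "z * u = 1" shows "poly (cheb n) (z + u) = z ^ n + u ^ n"
proof (induction n rule: cheb.induct)
  case (3 n)
  have "(z + u) * (z ^ Suc n + u ^ Suc n) = z ^ Suc (Suc n) + u ^ Suc (Suc n) + (z * u) * (z ^ n + u ^ n)"
    by (simp add: algebra_simps)
  then show ?case using 3 assms by simp
qed simp_all

lemma coeff_cheb_gt: "k > n \<Longrightarrow> coeff (cheb n) k = 0"
proof (induction n arbitrary: k rule: cheb.induct)
  case (3 n)
  then obtain j where "k = Suc j" by (cases k) auto
  then show ?case using 3 by simp
qed (auto simp: coeff_pCons split: nat.splits)

lemma coeff_cheb_top: "coeff (cheb (Suc n)) (Suc n) = 1"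
  by (induction n rule: less_induct) (case_tac x; simp add: coeff_cheb_gt)

lemma coeff_cheb_top1: "coeff (cheb (Suc n)) n = 0"
proof (induction n)
  case (Suc n) then show ?case by (simp add: coeff_cheb_gt)
qed simp

lemma coeff_cheb_top2: "coeff (cheb (Suc (Suc n))) n = - of_nat (n + 2)"
proof (induction n)
  case (Suc n)
  have "coeff (cheb (Suc (Suc (Suc n)))) (Suc n) = coeff (cheb (Suc (Suc n))) n - coeff (cheb (Suc n)) (Suc n)"
    by simp
  then show ?case using Suc coeff_cheb_top[of n] by (simp del: cheb.simps)
qed simp

lemma degree_cheb: "degree (cheb (Suc n)) = Suc n"
  using coeff_cheb_top[of n] coeff_cheb_gt[of "Suc n"]
  by (metis degree_le le_antisym le_degree zero_neq_one)

text \<open>The vanishing second coefficient forces the centre \<open>b\<close> to be 0, and then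
  the third coefficient would vanish too. From degree 3 on it is not the constant term, so
  \<open>c\<close> cannot account for it.\<close>

lemma cheb_not_power_equivalent: "\<not> power_equivalent p (cheb (Suc (Suc (Suc n))))"
proof
  define N where "N = Suc (Suc (Suc n))"
  assume "power_equivalent p (cheb (Suc (Suc (Suc n))))"
  moreover from this have "p = N" using degree_power_equivalent degree_cheb unfolding N_def by metis
  ultimately obtain a b c where a: "a \<noteq> 0" and eq: "cheb N = smult a ([:-b, 1:] ^ N) + [:c:]"
    unfolding power_equivalent_def N_def by blast
  have co: "coeff (cheb N) (Suc k) = a * (of_nat (N choose Suc k) * (-b) ^ (N - Suc k))" if "Suc k \<le> N" for k
    unfolding eq using that by (simp add: coeff_linear_poly_power)
  have "coeff (cheb N) (Suc (Suc n)) = 0" unfolding N_def by (rule coeff_cheb_top1)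
  then have "(of_nat (3 + n) :: complex) * b = 0" using a co[of "Suc n"] by (auto simp: N_def)
  then have "b = 0" by (simp del: of_nat_add)
  then have "coeff (cheb N) (Suc n) = 0" using co[of n] by (simp add: N_def)
  moreover have "coeff (cheb N) (Suc n) = - of_nat (Suc n + 2)" unfolding N_def by (rule coeff_cheb_top2)
  ultimately show False by (simp del: of_nat_Suc of_nat_add add: of_nat_eq_0_iff)
qed

section \<open>The obstruction to an extension\<close>

definition joukowski :: "sphere \<Rightarrow> sphere" where
  "joukowski = rat_map [:1, 0, 1:] [:0, 1:]"

lemma joukowski_simps [simp]:
  "joukowski None = None"
  "joukowski (Some z) = (if z = 0 then None else Some (z + 1 / z))"
  by (simp_all add: joukowski_def rat_map_def Let_def add_divide_distrib)

lemma coprime_polyI: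
  fixes P Q :: "complex poly"
  assumes "u * P + v * Q = 1" shows "coprime P Q"
  by (rule coprimeI) (metis assms dvd_add dvd_mult)

lemma joukowski_in_Rat_maps: "joukowski \<in> Rat_maps"
proof -
  have "coprime [:1, 0, 1:] [:0, 1::complex:]"
    by (rule coprime_polyI[of 1 _ "[:0, -1:]"]) (simp add: one_pCons)
  then show ?thesis unfolding Rat_maps_def joukowski_def by blast
qed

text \<open>Away from 0 and infinity this is \<open>poly_cheb\<close> for \<open>z\<close> and
  \<open>1/z\<close>; both sides send those two points to infinity.\<close>

lemma cheb_joukowski:
  assumes "n > 0"
  shows "poly_map (cheb n) \<circ> joukowski = joukowski \<circ> poly_map (monom 1 n)"
proof
  fix x
  have d: "degree (cheb n) = n" using degree_cheb assms by (metis Suc_pred)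
  show "(poly_map (cheb n) \<circ> joukowski) x = (joukowski \<circ> poly_map (monom 1 n)) x"
    using d assms
    by (cases x) (auto simp: poly_map_None degree_monom_eq poly_monom poly_cheb power_one_over)
qed

text \<open>\<open>cayley\<close> moves the critical points 1 and -1 of \<open>joukowski\<close> to
  0 and infinity, and \<open>cayley2\<close> does the same for its critical values 2 and -2, which
  turns it into the square.\<close>

definition cayley :: "sphere \<Rightarrow> sphere" where "cayley = rat_map [:-1, 1:] [:1, 1:]"
definition cayley_inv :: "sphere \<Rightarrow> sphere" where "cayley_inv = rat_map [:1, 1:] [:1, -1:]"
definition cayley2 :: "sphere \<Rightarrow> sphere" where "cayley2 = rat_map [:-2, 1:] [:2, 1:]"

lemma cayley_simps [simp]:
  "cayley None = Some 1" "cayley (Some z) = (if z = -1 then None else Some ((z - 1) / (z + 1)))"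
  "cayley_inv None = Some (-1)" "cayley_inv (Some z) = (if z = 1 then None else Some ((1 + z) / (1 - z)))"
  "cayley2 None = Some 1" "cayley2 (Some z) = (if z = -2 then None else Some ((z - 2) / (z + 2)))"
  by (auto simp: cayley_def cayley_inv_def cayley2_def rat_map_def Let_def add_eq_0_iff)

lemma cayley_in_Rat_maps: "cayley \<in> Rat_maps" "cayley_inv \<in> Rat_maps" "cayley2 \<in> Rat_maps"
proof -
  have "coprime [:-1, 1:] [:1, 1::complex:]"
    by (rule coprime_polyI[of "[:-1/2:]" _ "[:1/2:]"]) (simp add: one_pCons)
  then show "cayley \<in> Rat_maps" unfolding Rat_maps_def cayley_def by blast
  have "coprime [:1, 1:] [:1, -1::complex:]"
    by (rule coprime_polyI[of "[:1/2:]" _ "[:1/2:]"]) (simp add: one_pCons)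
  then show "cayley_inv \<in> Rat_maps" unfolding Rat_maps_def cayley_inv_def by blast
  have "coprime [:-2, 1:] [:2, 1::complex:]"
    by (rule coprime_polyI[of "[:-1/4:]" _ "[:1/4:]"]) (simp add: one_pCons)
  then show "cayley2 \<in> Rat_maps" unfolding Rat_maps_def cayley2_def by blast
qed

text \<open>A left inverse suffices to keep a character with value 1 at the identity from vanishing
  at \<open>cayley\<close>.\<close>

lemma cayley_inverse: "cayley_inv \<circ> cayley = poly_map [:0, 1:]"
  unfolding poly_map_id
proof
  fix x
  show "(cayley_inv \<circ> cayley) x = id x"
  proof (cases x)
    case (Some z)
    have "(1 + (z - 1) / (z + 1)) / (1 - (z - 1) / (z + 1)) = z" "(z - 1) / (z + 1) \<noteq> 1" if "z \<noteq> -1"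
    proof -
      have z: "z + 1 \<noteq> 0" using that by (simp add: add_eq_0_iff2)
      then have "1 + (z - 1) / (z + 1) = 2 * z / (z + 1)" "1 - (z - 1) / (z + 1) = 2 / (z + 1)"
        by (simp_all add: field_simps)
      then show "(1 + (z - 1) / (z + 1)) / (1 - (z - 1) / (z + 1)) = z" using z by simp
      show "(z - 1) / (z + 1) \<noteq> 1" using z by (simp add: divide_eq_1_iff)
    qed
    then show ?thesis using Some by simp
  qed simp
qed

lemma cayley_joukowski: "cayley2 \<circ> joukowski = poly_map (monom 1 2) \<circ> cayley"
proof
  fix x :: sphere
  show "(cayley2 \<circ> joukowski) x = (poly_map (monom 1 2) \<circ> cayley) x"
  proof (cases x)
    case None then show ?thesis by (simp add: poly_monom)
  next
    case (Some z)
    show ?thesis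
    proof (cases "z = 0 \<or> z = -1")
      case True then show ?thesis using Some by (auto simp: poly_monom poly_map_None degree_monom_eq)
    next
      case False
      then have z: "z \<noteq> 0" "z + 1 \<noteq> 0" by (auto simp: add_eq_0_iff2)
      have s: "z + 1 / z + 2 = (z + 1)\<^sup>2 / z" "z + 1 / z - 2 = (z - 1)\<^sup>2 / z"
        using z(1) by (simp_all add: nonzero_eq_divide_eq power2_eq_square distrib_left distrib_right
            left_diff_distrib right_diff_distrib)
      have "z + 1 / z + 2 \<noteq> 0" using z unfolding s by simp
      then have "z + 1 / z \<noteq> -2" by (metis add.left_inverse)
      moreover have "(z + 1 / z - 2) / (z + 1 / z + 2) = ((z - 1) / (z + 1))\<^sup>2"
        unfolding s using z by (simp add: power_divide)
      ultimately show ?thesis using Some False by (simp add: poly_monom)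
    qed
  qed
qed

section \<open>Well-definedness, multiplicativity and the two negative claims\<close>

theorem mainTheorem1:
  fixes p :: nat
  assumes "prime p" and "p \<ge> 3"
  shows "(\<forall>P. degree P > 0 \<longrightarrow> (\<exists>!v. phi1_value p P v))
    \<and> (\<forall>P. comp_prime P \<longrightarrow> phi1 p P = phi1_prime p P)
    \<and> (\<forall>P Ps. prime_decomposition P Ps \<longrightarrow> phi1 p P = prod_list (map (phi1 p) Ps))
    \<and> mult_character UNIV pcompose (phi1 p)
    \<and> \<not> elementary_character (phi1 p)
    \<and> \<not> (\<exists>\<Phi> :: (sphere \<Rightarrow> sphere) \<Rightarrow> complex.
          mult_character Rat_maps (\<circ>) \<Phi> \<and> (\<forall>P. \<Phi> (poly_map P) = phi1 p P))"
proof -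
  have p1: "p > 1" using assms by simp
  note value_eq = phi1_value_eq_weight_value[OF p1]
  have ex1: "\<exists>!v. phi1_value p P v" if P: "degree P > 0" for P
  proof -
    obtain v where "weight_value p P v"
      using prime_decomposition_exists[OF P] unfolding weight_value_def by blast
    then show ?thesis unfolding value_eq using weight_value_unique[OF assms(1)] by blast
  qed
  have val: "phi1 p P = v" if "weight_value p P v" for P v
  proof -
    have "degree P > 0"
      using that prime_decomposition_degree_pos unfolding weight_value_def by blast
    then show ?thesis unfolding phi1_def
      using that the1_equality[OF ex1] unfolding value_eq by simp
  qed
  have prime: "phi1 p P = prime_weight p P" if "comp_prime P" for P
    using val weight_value_prime[OF that] by blast
  have dec: "phi1 p P = prod_list (map (phi1 p) Ps)" if D: "prime_decomposition P Ps" for P Ps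
  proof -
    have "phi1 p P = prod_list (map (prime_weight p) Ps)"
      using val D unfolding weight_value_def by blast
    also have "map (prime_weight p) Ps = map (phi1 p) Ps"
      using D prime unfolding prime_decomposition_def by simp
    finally show ?thesis .
  qed
  have mult: "phi1 p (pcompose P Q) = phi1 p P * phi1 p Q" for P Q
  proof (cases "degree P > 0 \<and> degree Q > 0")
    case True
    then obtain v w where vw: "weight_value p P v" "weight_value p Q w"
      using prime_decomposition_exists unfolding weight_value_def by metis
    then show ?thesis using val weight_value_pcompose by metis
  next
    \<comment> \<open>A composition with a constant on either side is constant, so both sides are
      0.\<close>
    case False
    then have "degree (pcompose P Q) = 0" by (auto simp: degree_pcompose)
    then show ?thesis using False by (auto simp: phi1_def)
  qed
  define T where "T = cheb p"
  have dT: "degree T = p" unfolding T_def using degree_cheb[of "p - 1"] p1 by simp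
  have "T = cheb (Suc (Suc (Suc (p - 3))))" unfolding T_def using assms(2) 
    by (simp add: numeral_3_eq_3 Suc_diff_Suc del: cheb.simps)
  then have "\<not> power_equivalent p T" using cheb_not_power_equivalent by simp
  then have T: "phi1 p T = 1"
    using prime comp_prime_of_prime_degree dT assms(1) unfolding prime_weight_def by simp
  define Z where "Z = monom (1::complex) p"
  have dZ: "degree Z = p" unfolding Z_def by (simp add: degree_monom_eq)
  have "Z = smult 1 ([:-0, 1:] ^ p) + [:0:]" unfolding Z_def by (simp add: monom_altdef)
  then have "power_equivalent p Z" unfolding power_equivalent_def by (metis one_neq_zero)
  then have Z: "phi1 p Z = of_nat p"
    using prime comp_prime_of_prime_degree dZ assms(1) unfolding prime_weight_def by simp
  have pc: "(of_nat p :: complex) \<noteq> 1" using p1 by simp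
  \<comment> \<open>\<open>T\<close> and \<open>Z\<close> have the same degree but the values 1 and
    \<open>p\<close>.\<close>
  have "\<not> elementary_character (phi1 p)"
    unfolding elementary_character_def using T Z dT dZ pc by metis
  moreover have "False" if \<Phi>: "mult_character Rat_maps (\<circ>) \<Phi>" "\<And>P. \<Phi> (poly_map P) = phi1 p P" for \<Phi>
  proof -
    have hom: "\<Phi> (R \<circ> S) = \<Phi> R * \<Phi> S" if "R \<in> Rat_maps" "S \<in> Rat_maps" for R S
      using \<Phi>(1) that unfolding mult_character_def by blast
    \<comment> \<open>The semiconjugacy says that the value at \<open>joukowski\<close> equals
      \<open>p\<close> times itself.\<close>
    have "\<Phi> (poly_map T) * \<Phi> joukowski = \<Phi> joukowski * \<Phi> (poly_map Z)"
      using cheb_joukowski[of p] p1 hom joukowski_in_Rat_maps poly_map_in_Rat_maps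
      unfolding T_def Z_def by (metis gr_implies_not_zero gr0I)
    then have "\<Phi> joukowski = 0" unfolding \<Phi>(2) T Z using pc by simp
    have "degree (monom (1::complex) 2) = 2" by (simp add: degree_monom_eq)
    \<comment> \<open>The degree 2 is a prime below \<open>p\<close>, so the square is prime and not
      equivalent to \<open>z^p\<close>.\<close>
    then have sq: "phi1 p (monom 1 2) = 1"
      using prime[OF comp_prime_of_prime_degree] degree_power_equivalent[of p "monom 1 2"] assms(2)
      unfolding prime_weight_def by (auto simp: two_is_prime_nat)
    have "\<Phi> cayley2 * \<Phi> joukowski = phi1 p (monom 1 2) * \<Phi> cayley"
      using cayley_joukowski hom cayley_in_Rat_maps joukowski_in_Rat_maps poly_map_in_Rat_maps \<Phi>(2)
      by metis
    then have "\<Phi> cayley = 0" using \<open>\<Phi> joukowski = 0\<close> sq by simp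
    moreover have "\<Phi> cayley_inv * \<Phi> cayley = phi1 p [:0, 1:]"
      using cayley_inverse hom cayley_in_Rat_maps \<Phi>(2) by metis
    moreover have "phi1 p [:0, 1:] = 1" using val weight_value_linear p1 by simp
    ultimately show False by simp
  qed
  moreover have "phi1 p P = phi1_prime p P" if "comp_prime P" for P
    using prime[OF that] phi1_prime_eq_prime_weight[OF p1] by simp
  ultimately show ?thesis using ex1 dec mult unfolding mult_character_def by blast
qed

end
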